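(* There exists a universal constant $C$ such that, for every integer $n\ge 2$ and every integer partition $\lambda\vdash n$, $$D(\lambda)\le d_\lambda^{\,1+\frac{C}{\ln n}}.$$
   Context: For an integer partition $\lambda\vdash n$ (identified with its Young diagram), $\lambda_i$ is the length of the $i$-th row and $\lambda'_i$ the length of the $i$-th column. $d_\lambda$ is the dimension of the irreducible representation of the symmetric group $\mathfrak{S}_n$ associated with $\lambda$ (equivalently, the number of standard Young tableaux of shape $\lambda$). Let $\delta$ be the diagonal length of $\lambda$, i.e. the number of $i$ with $\lambda_i\ge i$. For $1\le i\le\delta$ put $a_i=\lambda_i-i$ and $b_i=\lambda'_i-i$. The virtual degree of $\lambda$ is $$D(\lambda)=\frac{(n-1)!}{\prod_{i=1}^{\delta}a_i!\,b_i!}.$$ *)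

theory Defs
  imports Complex_Main "HOL-Library.FuncSet"
begin

text \<open>
  An integer partition is the list of its row lengths (positive parts in non-increasing order).
  Rows and columns are numbered from 1.
\<close>

definition partition_of :: "nat list \<Rightarrow> nat \<Rightarrow> bool" (infix "\<turnstile>\<^sub>p" 50) where
  "l \<turnstile>\<^sub>p n \<longleftrightarrow> sorted_wrt (\<ge>) l \<and> (\<forall>x\<in>set l. 0 < x) \<and> sum_list l = n"

definition row_length :: "nat list \<Rightarrow> nat \<Rightarrow> nat" where
  "row_length l i = (if 1 \<le> i \<and> i \<le> length l then l ! (i - 1) else 0)"

definition young_diagram :: "nat list \<Rightarrow> (nat \<times> nat) set" where
  "young_diagram l = {(i, j). 1 \<le> i \<and> 1 \<le> j \<and> j \<le> row_length l i}"

definition col_length :: "nat list \<Rightarrow> nat \<Rightarrow> nat" where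
  "col_length l j = card {i. (i, j) \<in> young_diagram l}"

text \<open>
  Tableaux are taken extensional, i.e. with a fixed value outside the diagram, so that each
  standard filling of the diagram corresponds to exactly one function.
\<close>

definition standard_tableaux :: "nat list \<Rightarrow> (nat \<times> nat \<Rightarrow> nat) set" where
  "standard_tableaux l =
     {T \<in> extensional (young_diagram l).
        bij_betw T (young_diagram l) {1..sum_list l} \<and>
        (\<forall>i j j'. (i, j) \<in> young_diagram l \<and> (i, j') \<in> young_diagram l \<and> j < j'
            \<longrightarrow> T (i, j) < T (i, j')) \<and>
        (\<forall>i i' j. (i, j) \<in> young_diagram l \<and> (i', j) \<in> young_diagram l \<and> i < i'
            \<longrightarrow> T (i, j) < T (i', j))}"

text \<open>
  The dimension of the irreducible representation of the symmetric group associated with the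
  partition, in its combinatorial form: the number of standard Young tableaux of that shape.
\<close>

definition irrep_dim :: "nat list \<Rightarrow> nat" where
  "irrep_dim l = card (standard_tableaux l)"

definition diagonal_length :: "nat list \<Rightarrow> nat" where
  "diagonal_length l = card {i. 1 \<le> i \<and> i \<le> row_length l i}"

text \<open>
  For a partition and \<open>i \<le> diagonal_length l\<close>, both the \<open>i\<close>-th row and the \<open>i\<close>-th column have
  length at least \<open>i\<close>, so the natural-number subtractions below do not truncate.
\<close>

definition virtual_degree :: "nat list \<Rightarrow> real" where
  "virtual_degree l =
     fact (sum_list l - 1) /
     (\<Prod>i = 1..diagonal_length l. fact (row_length l i - i) * fact (col_length l i - i))"

end

theory Submission
  imports Defs "HOL-Real_Asymp.Real_Asymp"
begin

text \<open>
  By the hook length bound \<open>d \<ge> n! / \<Prod> h\<close>, where \<open>h\<close> runs over the hook lengths, it suffices to bound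
  \<open>S = ln (D \<Prod> h / n!)\<close> by \<open>O (ln D / ln n)\<close>. The factorial \<open>a\<^sub>i!\<close> is the product of the arm lengths
  plus one over the cells of row \<open>i\<close> to the right of the diagonal, so \<open>S\<close> is a sum over cells of
  logarithms of ratios of hook to arm lengths (or leg lengths, below the diagonal). Estimated row by
  row these give \<open>S \<le> 2\<delta>\<^sup>2 + 3 \<Sum> ln (p + \<delta> choose \<delta>)\<close> with \<open>p\<close> ranging over the Frobenius
  coordinates, and the longest row contributes at most \<open>k\<close>, the number of cells outside of it.

  If \<open>k \<le> n powr 0.95\<close>, then \<open>S = O(k)\<close>, while \<open>D \<ge> (n - 1 choose k)\<close> gives \<open>ln D \<ge> c k ln n\<close>.
  Otherwise \<open>ln D \<ge> c n powr 0.95\<close>; there are at most \<open>n powr 0.4\<close> coordinates \<open>p > n powr 0.6\<close>, and they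
  contribute only \<open>O(n powr 0.9 * ln n)\<close> to \<open>S\<close>, while the sum \<open>s\<close> of the remaining ones controls
  the rest of \<open>S\<close> and satisfies \<open>ln D \<ge> c s ln n\<close>.
\<close>

section \<open>Diagrams and the hook length bound\<close>

text \<open>The longest row must not enter through its binomial coefficient: that would cost about
  \<delta> ln n, which is not O(k) for small k, whence its separate bound. The hook of the cell
  \<open>(1, 1)\<close> would cost another ln n; it is paid for by the factor n between the
  \<open>n!\<close> of the hook bound and the \<open>(n - 1)!\<close> of D. The exponents fit
  together as follows. Coordinates above \<open>n powr 0.6\<close> number at most
  \<open>n powr 0.4\<close>, and \<delta> is at most \<open>n powr 0.5\<close>, so their cost has
  exponent 0.9; the gap from 0.9 to 0.95 absorbs the square of ln n, and the gap from 0.95 to 1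
  keeps k ln (n / k) of order k ln n in the first case. The error is measured by ln D; for large n
  it is at most half of ln D, so that ln D can be replaced by 2 ln d. For small n the constant rests
  on d \<ge> 2, which holds outside single rows and columns; there D = 1.\<close>

definition diagram :: "(nat \<times> nat) set \<Rightarrow> bool" where
  "diagram Y \<longleftrightarrow> finite Y \<and> (\<forall>i j. (i, j) \<in> Y \<longrightarrow> 1 \<le> i \<and> 1 \<le> j) \<and>
     (\<forall>i j i' j'. (i, j) \<in> Y \<longrightarrow> 1 \<le> i' \<longrightarrow> i' \<le> i \<longrightarrow> 1 \<le> j' \<longrightarrow> j' \<le> j \<longrightarrow> (i', j') \<in> Y)"

definition row :: "(nat \<times> nat) set \<Rightarrow> nat \<Rightarrow> nat" where
  "row Y i = card {j. (i, j) \<in> Y}"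

definition col :: "(nat \<times> nat) set \<Rightarrow> nat \<Rightarrow> nat" where
  "col Y j = card {i. (i, j) \<in> Y}"

definition hook :: "(nat \<times> nat) set \<Rightarrow> nat \<Rightarrow> nat \<Rightarrow> nat" where
  "hook Y i j = (row Y i - j) + (col Y j - i) + 1"

definition hook_prod :: "(nat \<times> nat) set \<Rightarrow> real" where
  "hook_prod Y = (\<Prod>(i, j)\<in>Y. real (hook Y i j))"

definition corners :: "(nat \<times> nat) set \<Rightarrow> (nat \<times> nat) set" where
  "corners Y = {(r, s). (r, s) \<in> Y \<and> row Y r = s \<and> col Y s = r}"

definition conjugate :: "(nat \<times> nat) set \<Rightarrow> (nat \<times> nat) set" where
  "conjugate Y = prod.swap ` Y"

lemma mem_conjugate [simp]: "(i, j) \<in> conjugate Y \<longleftrightarrow> (j, i) \<in> Y"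
  by (force simp: conjugate_def)

lemma row_conjugate [simp]: "row (conjugate Y) = col Y"
  by (auto simp: row_def col_def fun_eq_iff)

lemma col_conjugate [simp]: "col (conjugate Y) = row Y"
  by (auto simp: row_def col_def fun_eq_iff)

lemma diagram_conjugate:
  assumes "diagram Y"
  shows "diagram (conjugate Y)"
  unfolding diagram_def mem_conjugate
proof (intro conjI)
  have "finite Y" using assms unfolding diagram_def by blast
  then show "finite (conjugate Y)" by (simp add: conjugate_def)
qed (use assms in \<open>unfold diagram_def, blast+\<close>)

lemma card_conjugate [simp]: "card (conjugate Y) = card Y"
  by (simp add: conjugate_def card_image)

lemma finite_diagram: "diagram Y \<Longrightarrow> finite Y"
  unfolding diagram_def by blast

lemma diagram_pos: "diagram Y \<Longrightarrow> (i, j) \<in> Y \<Longrightarrow> 1 \<le> i \<and> 1 \<le> j"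
  unfolding diagram_def by blast

lemma diagram_down:
  "diagram Y \<Longrightarrow> (i, j) \<in> Y \<Longrightarrow> 1 \<le> i' \<Longrightarrow> i' \<le> i \<Longrightarrow> 1 \<le> j' \<Longrightarrow> j' \<le> j \<Longrightarrow> (i', j') \<in> Y"
  unfolding diagram_def by blast

lemma down_set_eq:
  fixes S :: "nat set"
  assumes "finite S" "\<And>x. x \<in> S \<Longrightarrow> 1 \<le> x" "\<And>x y. x \<in> S \<Longrightarrow> 1 \<le> y \<Longrightarrow> y \<le> x \<Longrightarrow> y \<in> S"
  shows "S = {1..card S}"
proof (cases "S = {}")
  case False
  have "S = {1..Max S}"
  proof (intro equalityI subsetI)
    fix x assume "x \<in> S"
    then show "x \<in> {1..Max S}" using assms(1,2) by simp
  next
    fix x assume "x \<in> {1..Max S}"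
    then show "x \<in> S" using assms(3)[OF Max_in[OF assms(1) False], of x] by simp
  qed
  moreover from this have "card S = Max S" by (metis card_atLeastAtMost diff_Suc_1)
  ultimately show ?thesis by simp
qed auto

lemma mem_row:
  assumes "diagram Y"
  shows "(i, j) \<in> Y \<longleftrightarrow> 1 \<le> j \<and> j \<le> row Y i"
proof -
  have "finite {j. (i, j) \<in> Y}"
    using finite_diagram[OF assms] by (rule finite_subset[rotated, OF finite_imageI[of _ snd]]) force
  then have "{j. (i, j) \<in> Y} = {1..row Y i}"
    unfolding row_def
    by (rule down_set_eq) (use diagram_pos[OF assms] diagram_down[OF assms] in blast)+
  then show ?thesis by (auto simp: set_eq_iff)
qed

lemma mem_col:
  assumes "diagram Y"
  shows "(i, j) \<in> Y \<longleftrightarrow> 1 \<le> i \<and> i \<le> col Y j"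
  using mem_row[OF diagram_conjugate[OF assms], of j i] by simp

lemma row_ge: "diagram Y \<Longrightarrow> (i, j) \<in> Y \<Longrightarrow> j \<le> row Y i"
  by (simp add: mem_row)

lemma col_ge: "diagram Y \<Longrightarrow> (i, j) \<in> Y \<Longrightarrow> i \<le> col Y j"
  by (simp add: mem_col)

lemma row_antimono:
  assumes "diagram Y" "1 \<le> i" "i \<le> i'"
  shows "row Y i' \<le> row Y i"
  using assms by (metis diagram_down le_0_eq mem_row nat_le_linear not_less_eq_eq One_nat_def)

lemma col_antimono:
  assumes "diagram Y" "1 \<le> j" "j \<le> j'"
  shows "col Y j' \<le> col Y j"
  using row_antimono[OF diagram_conjugate[OF assms(1)] assms(2,3)] by simp

section \<open>Corners and their removal\<close>

lemma finite_corners: "diagram Y \<Longrightarrow> finite (corners Y)"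
  by (rule finite_subset[of _ Y]) (auto simp: corners_def finite_diagram)

lemma cornersD:
  assumes "(r, s) \<in> corners Y"
  shows "(r, s) \<in> Y" "row Y r = s" "col Y s = r"
  using assms by (auto simp: corners_def)

lemma corner_maximal:
  assumes "diagram Y" "(r, s) \<in> corners Y" "(i, j) \<in> Y" "r \<le> i" "s \<le> j"
  shows "i = r \<and> j = s"
proof -
  note c = cornersD[OF assms(2)]
  have pos: "1 \<le> r" "1 \<le> s" using diagram_pos[OF assms(1) c(1)] by auto
  have "(i, s) \<in> Y" using diagram_down[OF assms(1,3), of i s] assms pos by auto
  then have "i \<le> r" using mem_col[OF assms(1)] c by auto
  moreover have "(r, j) \<in> Y" using diagram_down[OF assms(1,3), of r j] assms pos by auto
  then have "j \<le> s" using mem_row[OF assms(1)] c by auto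
  ultimately show ?thesis using assms by auto
qed

lemma diagram_remove:
  assumes Y: "diagram Y" and c: "c \<in> corners Y"
  shows "diagram (Y - {c})"
proof -
  obtain r s where rs: "c = (r, s)" by fastforce
  show ?thesis
    unfolding diagram_def
  proof (intro conjI allI impI)
    fix i j i' j'
    assume ij: "(i, j) \<in> Y - {c}" "1 \<le> i'" "i' \<le> i" "1 \<le> j'" "j' \<le> j"
    then have "(i', j') \<in> Y" using diagram_down[OF Y] by blast
    moreover have "(i', j') \<noteq> c"
      using corner_maximal[OF Y, of r s i j] c ij rs by auto
    ultimately show "(i', j') \<in> Y - {c}" by auto
  qed (use finite_diagram[OF Y] diagram_pos[OF Y] in auto)
qed

lemma row_remove:
  assumes Y: "diagram Y" and c: "(r, s) \<in> Y"
  shows "row (Y - {(r, s)}) i = (if i = r then row Y i - 1 else row Y i)"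
proof -
  have fin: "finite {j. (i, j) \<in> Y}"
    using finite_diagram[OF Y] by (rule finite_subset[rotated, OF finite_imageI[of _ snd]]) force
  show ?thesis
  proof (cases "i = r")
    case True
    have "{j. (i, j) \<in> Y - {(r, s)}} = {j. (i, j) \<in> Y} - {s}" using True by auto
    then show ?thesis using True fin c by (simp add: row_def)
  next
    case False
    then have "{j. (i, j) \<in> Y - {(r, s)}} = {j. (i, j) \<in> Y}" by auto
    then show ?thesis using False by (simp add: row_def)
  qed
qed

lemma conjugate_remove: "conjugate (Y - {(r, s)}) = conjugate Y - {(s, r)}"
  by (force simp: conjugate_def)

lemma col_remove:
  assumes "diagram Y" "(r, s) \<in> Y"
  shows "col (Y - {(r, s)}) j = (if j = s then col Y j - 1 else col Y j)"
  using row_remove[OF diagram_conjugate[OF assms(1)], of s r j] assms(2)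
  by (metis mem_conjugate row_conjugate conjugate_remove)

text \<open>
  The hook walk starts at a cell and jumps repeatedly to a uniformly chosen other cell of its hook,
  until it stops at a corner. The probability of ending at the corner \<open>(r, s)\<close> is a product of a
  row weight and a column weight, because the hook length minus one at a cell above and to the
  left of the corner is the sum of the same quantities on column \<open>s\<close> and on row \<open>r\<close>.
\<close>

definition walk_weight :: "(nat \<Rightarrow> real) \<Rightarrow> nat \<Rightarrow> nat \<Rightarrow> real" where
  "walk_weight x r i = (if i < r then 1 / x i else 1) * (\<Prod>k\<in>{i<..<r}. 1 + 1 / x k)"

text \<open>Telescoping: the term \<open>k = i + 1 < r\<close> is \<open>1 / x (i + 1)\<close> times
  the product for \<open>i + 1\<close>, so lowering \<open>i\<close> by one multiplies the sum by
  \<open>1 + 1 / x (i + 1)\<close>.\<close>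

lemma sum_walk_weight:
  assumes "i < r" and "\<And>k. i < k \<Longrightarrow> k < r \<Longrightarrow> x k \<noteq> 0"
  shows "(\<Sum>k\<in>{i<..r}. walk_weight x r k) = (\<Prod>k\<in>{i<..<r}. 1 + 1 / x k)"
  using assms
proof (induction "r - i" arbitrary: i)
  case 0
  then show ?case by simp
next
  case (Suc t)
  show ?case
  proof (cases "Suc i = r")
    case True
    then have "{i<..r} = {r}" "{i<..<r} = {}" by auto
    then show ?thesis by (simp add: walk_weight_def)
  next
    case False
    then have lt: "Suc i < r" using Suc by auto
    have IH: "(\<Sum>k\<in>{Suc i<..r}. walk_weight x r k) = (\<Prod>k\<in>{Suc i<..<r}. 1 + 1 / x k)"
      by (rule Suc(1)) (use Suc lt in auto)
    have "{i<..r} = insert (Suc i) {Suc i<..r}" "{i<..<r} = insert (Suc i) {Suc i<..<r}"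
      using lt by auto
    then show ?thesis using IH lt by (simp add: walk_weight_def algebra_simps)
  qed
qed

text \<open>One coordinate of the first-step equation: multiplying by \<open>x i\<close> cancels the
  leading \<open>1 / x i\<close>. At \<open>i = r\<close> both sides vanish because
  \<open>x r = 0\<close>.\<close>

lemma walk_weight_rec:
  assumes "i \<le> r" and "\<And>k. i \<le> k \<Longrightarrow> k < r \<Longrightarrow> x k \<noteq> 0" and "x r = 0"
  shows "(\<Sum>k\<in>{i<..r}. walk_weight x r k) = x i * walk_weight x r i"
proof (cases "i = r")
  case False
  then show ?thesis
    using assms sum_walk_weight[of i r x] by (simp add: walk_weight_def)
qed (use assms in auto)

text \<open>
  For \<open>i \<le> r\<close> this is the hook length of \<open>(i, s)\<close> minus one, if \<open>(r, s)\<close> is a corner.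
\<close>

definition row_excess :: "(nat \<times> nat) set \<Rightarrow> nat \<Rightarrow> nat \<Rightarrow> nat \<Rightarrow> real" where
  "row_excess Y r s i = real (row Y i) - real s + (real r - real i)"

text \<open>The closed form of the stopping probability serves as its definition;
  \<open>hook_walk_rec\<close> recovers the first-step equation. A corner that is not weakly below
  and to the right of \<open>(i, j)\<close> cannot be reached.\<close>

definition hook_walk :: "(nat \<times> nat) set \<Rightarrow> nat \<times> nat \<Rightarrow> nat \<Rightarrow> nat \<Rightarrow> real" where
  "hook_walk Y c i j = (if i \<le> fst c \<and> j \<le> snd c
     then walk_weight (row_excess Y (fst c) (snd c)) (fst c) i *
          walk_weight (row_excess (conjugate Y) (snd c) (fst c)) (snd c) j
     else 0)"

lemma row_excess_pos:
  assumes "diagram Y" "(r, s) \<in> corners Y" "1 \<le> i" "i < r"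
  shows "row_excess Y r s i > 0"
  using row_antimono[OF assms(1,3), of r] assms cornersD[OF assms(2)]
  by (simp add: row_excess_def)

lemma corners_conjugate: "(s, r) \<in> corners (conjugate Y) \<longleftrightarrow> (r, s) \<in> corners Y"
  by (auto simp: corners_def)

lemma row_excess_corner: "(r, s) \<in> corners Y \<Longrightarrow> row_excess Y r s r = 0"
  by (simp add: row_excess_def corners_def)

lemma hook_excess:
  assumes "diagram Y" "(i, j) \<in> Y"
  shows "real (hook Y i j) - 1 = row_excess Y r s i + row_excess (conjugate Y) s r j"
  using row_ge[OF assms] col_ge[OF assms] by (simp add: hook_def row_excess_def of_nat_diff)

text \<open>First-step equation, with the number of other cells of the hook as left factor. By
  \<open>hook_excess\<close> this number is a row term plus a column term, and each of them turns
  one weight of the product into its sum over later indices.\<close>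

lemma hook_walk_rec:
  assumes Y: "diagram Y" and c: "c \<in> corners Y" and ij: "(i, j) \<in> Y"
  shows "(real (hook Y i j) - 1) * hook_walk Y c i j =
     (\<Sum>k\<in>{i<..col Y j}. hook_walk Y c k j) + (\<Sum>k\<in>{j<..row Y i}. hook_walk Y c i k)"
proof -
  obtain r s where rs: "c = (r, s)" by fastforce
  have c': "(r, s) \<in> corners Y" "(s, r) \<in> corners (conjugate Y)"
    using c rs by (auto simp: corners_conjugate)
  note C = cornersD[OF c'(1)]
  have pos: "1 \<le> i" "1 \<le> j" using diagram_pos[OF Y ij] by auto
  show ?thesis
  proof (cases "i \<le> r \<and> j \<le> s")
    case True
    define u where "u = walk_weight (row_excess Y r s) r"
    define v where "v = walk_weight (row_excess (conjugate Y) s r) s"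
    have "r \<le> col Y j" "s \<le> row Y i"
      using diagram_down[OF Y C(1), of r j] diagram_down[OF Y C(1), of i s]
        diagram_pos[OF Y C(1)] True pos col_ge[OF Y, of r j] row_ge[OF Y, of i s] by simp_all
    have nz: "row_excess Y r s k \<noteq> 0" if "i \<le> k" "k < r" for k
      using row_excess_pos[OF Y c'(1), of k] that pos by simp
    have nz': "row_excess (conjugate Y) s r k \<noteq> 0" if "j \<le> k" "k < s" for k
      using row_excess_pos[OF diagram_conjugate[OF Y] c'(2), of k] that pos by simp
    have "(\<Sum>k\<in>{i<..col Y j}. hook_walk Y c k j) = (\<Sum>k\<in>{i<..r}. u k * v j)"
      by (rule sum.mono_neutral_cong_right)
        (use \<open>r \<le> col Y j\<close> True in \<open>auto simp: hook_walk_def rs u_def v_def\<close>)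
    also have "\<dots> = row_excess Y r s i * u i * v j"
      unfolding sum_distrib_right[symmetric] u_def
      using walk_weight_rec[of i r "row_excess Y r s"] True nz row_excess_corner[OF c'(1)] by simp
    finally have 1: "(\<Sum>k\<in>{i<..col Y j}. hook_walk Y c k j) = row_excess Y r s i * u i * v j" .
    have "(\<Sum>k\<in>{j<..row Y i}. hook_walk Y c i k) = (\<Sum>k\<in>{j<..s}. u i * v k)"
      by (rule sum.mono_neutral_cong_right)
        (use \<open>s \<le> row Y i\<close> True in \<open>auto simp: hook_walk_def rs u_def v_def\<close>)
    also have "\<dots> = u i * (row_excess (conjugate Y) s r j * v j)"
      unfolding sum_distrib_left[symmetric] v_def
      using walk_weight_rec[of j s "row_excess (conjugate Y) s r"] True nz'
        row_excess_corner[OF c'(2)] by simp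
    finally have 2: "(\<Sum>k\<in>{j<..row Y i}. hook_walk Y c i k) =
      u i * (row_excess (conjugate Y) s r j * v j)" .
    have "hook_walk Y c i j = u i * v j" using True by (simp add: hook_walk_def rs u_def v_def)
    then show ?thesis
      unfolding 1 2 hook_excess[OF Y ij, of r s] by (simp add: algebra_simps)
  next
    case False
    then have "hook_walk Y c i j = 0"
      and "\<And>k. k \<in> {i<..col Y j} \<Longrightarrow> hook_walk Y c k j = 0"
      and "\<And>k. k \<in> {j<..row Y i} \<Longrightarrow> hook_walk Y c i k = 0"
      by (auto simp: hook_walk_def rs)
    then show ?thesis by simp
  qed
qed

text \<open>All other cells of a hook have shorter hooks, so by induction
  \<open>hook_walk_rec\<close> averages ones. Hook length 1 means that the cell is itself a corner,
  where the walk stays.\<close>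

lemma sum_hook_walk:
  assumes Y: "diagram Y"
  shows "(i, j) \<in> Y \<Longrightarrow> (\<Sum>c\<in>corners Y. hook_walk Y c i j) = 1"
proof (induction "hook Y i j" arbitrary: i j rule: less_induct)
  case less
  note pos = diagram_pos[OF Y less.prems]
  note ge = row_ge[OF Y less.prems] col_ge[OF Y less.prems]
  show ?case
  proof (cases "hook Y i j = 1")
    case True
    then have c: "(i, j) \<in> corners Y"
      using ge less.prems by (auto simp: hook_def corners_def)
    have "hook_walk Y c i j = (if c = (i, j) then 1 else 0)" if "c \<in> corners Y" for c
    proof -
      obtain r s where rs: "c = (r, s)" by fastforce
      show ?thesis
        using corner_maximal[OF Y c, of r s] cornersD[of r s Y] that
        by (auto simp: hook_walk_def rs walk_weight_def)
    qed
    then show ?thesis using c finite_corners[OF Y] by (simp cong: sum.cong)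
  next
    case False
    let ?w = "\<lambda>c. hook_walk Y c"
    have col: "(\<Sum>c\<in>corners Y. ?w c k j) = 1" if "k \<in> {i<..col Y j}" for k
    proof (rule less.hyps)
      show kj: "(k, j) \<in> Y" using that pos mem_col[OF Y] by auto
      show "hook Y k j < hook Y i j"
        using row_antimono[OF Y, of i k] that pos row_ge[OF Y kj] by (auto simp: hook_def)
    qed
    have row: "(\<Sum>c\<in>corners Y. ?w c i k) = 1" if "k \<in> {j<..row Y i}" for k
    proof (rule less.hyps)
      show ik: "(i, k) \<in> Y" using that pos mem_row[OF Y] by auto
      show "hook Y i k < hook Y i j"
        using col_antimono[OF Y, of j k] that pos col_ge[OF Y ik] by (auto simp: hook_def)
    qed
    have "(real (hook Y i j) - 1) * (\<Sum>c\<in>corners Y. ?w c i j) =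
      (\<Sum>c\<in>corners Y. (\<Sum>k\<in>{i<..col Y j}. ?w c k j) + (\<Sum>k\<in>{j<..row Y i}. ?w c i k))"
      unfolding sum_distrib_left by (rule sum.cong) (use hook_walk_rec[OF Y _ less.prems] in auto)
    also have "\<dots> = (\<Sum>k\<in>{i<..col Y j}. \<Sum>c\<in>corners Y. ?w c k j) +
                    (\<Sum>k\<in>{j<..row Y i}. \<Sum>c\<in>corners Y. ?w c i k)"
      by (simp add: sum.distrib sum.swap[of _ "corners Y"])
    also have "\<dots> = real (hook Y i j) - 1"
      using col row ge by (simp add: hook_def of_nat_diff)
    finally have "(real (hook Y i j) - 1) * (\<Sum>c\<in>corners Y. ?w c i j) = real (hook Y i j) - 1" .
    moreover have "real (hook Y i j) - 1 \<noteq> 0" using False by simp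
    ultimately show ?thesis by (metis mult_cancel_left2)
  qed
qed

text \<open>\<open>hook_walk\<close> is a product supported on the rectangle above and to the left
  of the corner, so the sum over all starting cells factors into two telescoping sums.\<close>

lemma sum_hook_walk_corner:
  assumes Y: "diagram Y" and c: "(r, s) \<in> corners Y"
  shows "(\<Sum>(i, j)\<in>Y. hook_walk Y (r, s) i j) =
     (\<Prod>k\<in>{0<..<r}. 1 + 1 / row_excess Y r s k) *
     (\<Prod>k\<in>{0<..<s}. 1 + 1 / row_excess (conjugate Y) s r k)"
proof -
  have c': "(s, r) \<in> corners (conjugate Y)" using c by (simp add: corners_conjugate)
  note C = cornersD[OF c]
  have pos: "1 \<le> r" "1 \<le> s" using diagram_pos[OF Y C(1)] by auto
  have "(\<Sum>(i, j)\<in>Y. hook_walk Y (r, s) i j) = (\<Sum>(i, j)\<in>{0<..r} \<times> {0<..s}.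
      walk_weight (row_excess Y r s) r i * walk_weight (row_excess (conjugate Y) s r) s j)"
  proof (rule sum.mono_neutral_cong_right)
    show "{0<..r} \<times> {0<..s} \<subseteq> Y" using diagram_down[OF Y C(1)] by auto
    show "\<forall>x\<in>Y - {0<..r} \<times> {0<..s}. (case x of (i, j) \<Rightarrow> hook_walk Y (r, s) i j) = 0"
    proof (rule ballI)
      fix x assume x: "x \<in> Y - {0<..r} \<times> {0<..s}"
      obtain i j where ij: "x = (i, j)" by fastforce
      then have "1 \<le> i" "1 \<le> j" "\<not> (i \<le> r \<and> j \<le> s)"
        using x diagram_pos[OF Y, of i j] by auto
      then show "(case x of (i, j) \<Rightarrow> hook_walk Y (r, s) i j) = 0"
        by (auto simp: ij hook_walk_def)
    qed
  qed (use finite_diagram[OF Y] in \<open>auto simp: hook_walk_def\<close>)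
  also have "\<dots> = (\<Sum>i\<in>{0<..r}. walk_weight (row_excess Y r s) r i) *
      (\<Sum>j\<in>{0<..s}. walk_weight (row_excess (conjugate Y) s r) s j)"
    by (simp add: sum_product sum.cartesian_product)
  also have "(\<Sum>i\<in>{0<..r}. walk_weight (row_excess Y r s) r i) =
      (\<Prod>k\<in>{0<..<r}. 1 + 1 / row_excess Y r s k)"
  proof (rule sum_walk_weight)
    show "row_excess Y r s k \<noteq> 0" if "0 < k" "k < r" for k
      using row_excess_pos[OF Y c, of k] that by simp
  qed (use pos in simp)
  also have "(\<Sum>j\<in>{0<..s}. walk_weight (row_excess (conjugate Y) s r) s j) =
      (\<Prod>k\<in>{0<..<s}. 1 + 1 / row_excess (conjugate Y) s r k)"
  proof (rule sum_walk_weight)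
    show "row_excess (conjugate Y) s r k \<noteq> 0" if "0 < k" "k < s" for k
      using row_excess_pos[OF diagram_conjugate[OF Y] c', of k] that by simp
  qed (use pos in simp)
  finally show ?thesis .
qed

lemma hook_prod_pos: "hook_prod Y > 0"
  unfolding hook_prod_def by (rule prod_pos) (auto simp: hook_def)

text \<open>Deleting the corner shortens, by one, exactly the other hooks in its row and its column.
  One of the two excesses vanishes there, so such a hook minus one is \<open>x i\<close> or
  \<open>y j\<close>, and the quotients multiply to the value in
  \<open>sum_hook_walk_corner\<close>.\<close>

lemma hook_prod_remove:
  assumes Y: "diagram Y" and c: "(r, s) \<in> corners Y"
  shows "hook_prod Y = hook_prod (Y - {(r, s)}) * (\<Sum>(i, j)\<in>Y. hook_walk Y (r, s) i j)"
proof -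
  note C = cornersD[OF c]
  have c': "(s, r) \<in> corners (conjugate Y)" using c by (simp add: corners_conjugate)
  define Y' where "Y' = Y - {(r, s)}"
  define x where "x = row_excess Y r s"
  define y where "y = row_excess (conjugate Y) s r"
  have fin: "finite Y" "finite Y'" using finite_diagram[OF Y] by (auto simp: Y'_def)
  have h: "real (hook Y i j) = real (hook Y' i j) *
      ((if j = s then 1 + 1 / x i else 1) * (if i = r then 1 + 1 / y j else 1))"
    if ij: "(i, j) \<in> Y'" for i j
  proof -
    have ijY: "(i, j) \<in> Y" "\<not> (i = r \<and> j = s)" using ij by (auto simp: Y'_def)
    note pos = diagram_pos[OF Y ijY(1)]
    note rY = row_remove[OF Y C(1)] and cY = col_remove[OF Y C(1)]
    note ge = row_ge[OF Y ijY(1)] col_ge[OF Y ijY(1)]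
    note he = hook_excess[OF Y ijY(1), of r s]
    consider "i = r" "j \<noteq> s" | "j = s" "i \<noteq> r" | "i \<noteq> r" "j \<noteq> s" using ijY by auto
    then show ?thesis
    proof cases
      case 1
      have "j < s" using 1 ge C by auto
      then have p: "y j > 0" using row_excess_pos[OF diagram_conjugate[OF Y] c', of j] pos
        by (simp add: y_def)
      have "hook Y i j = hook Y' i j + 1"
        using 1 \<open>j < s\<close> C ge by (simp add: hook_def Y'_def rY cY)
      moreover have "real (hook Y i j) - 1 = y j"
        using he 1 row_excess_corner[OF c] by (simp add: y_def)
      ultimately show ?thesis using 1 p by (simp add: field_simps)
    next
      case 2
      have "i < r" using 2 ge C by auto
      then have p: "x i > 0" using row_excess_pos[OF Y c, of i] pos
        by (simp add: x_def)
      have "hook Y i j = hook Y' i j + 1"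
        using 2 \<open>i < r\<close> C ge by (simp add: hook_def Y'_def rY cY)
      moreover have "real (hook Y i j) - 1 = x i"
        using he 2 row_excess_corner[OF c'] by (simp add: x_def)
      ultimately show ?thesis using 2 p by (simp add: field_simps)
    next
      case 3
      then show ?thesis by (simp add: hook_def Y'_def rY cY)
    qed
  qed
  have px: "(\<Prod>(i, j)\<in>Y'. if j = s then 1 + 1 / x i else 1) = (\<Prod>k\<in>{0<..<r}. 1 + 1 / x k)"
  proof -
    have "(\<Prod>(i, j)\<in>Y'. if j = s then 1 + 1 / x i else 1) =
        (\<Prod>(i, j)\<in>(\<lambda>i. (i, s)) ` {0<..<r}. 1 + 1 / x i)"
    proof (rule prod.mono_neutral_cong_right)
      show "(\<lambda>i. (i, s)) ` {0<..<r} \<subseteq> Y'"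
        using C mem_col[OF Y] by (auto simp: Y'_def)
      show "\<forall>x'\<in>Y' - (\<lambda>i. (i, s)) ` {0<..<r}. (case x' of (i, j) \<Rightarrow> if j = s then 1 + 1 / x i else 1) = 1"
        using C mem_col[OF Y] by (force simp: Y'_def)
    qed (use fin in auto)
    then show ?thesis by (simp add: prod.reindex inj_on_def)
  qed
  have py: "(\<Prod>(i, j)\<in>Y'. if i = r then 1 + 1 / y j else 1) = (\<Prod>k\<in>{0<..<s}. 1 + 1 / y k)"
  proof -
    have "(\<Prod>(i, j)\<in>Y'. if i = r then 1 + 1 / y j else 1) =
        (\<Prod>(i, j)\<in>Pair r ` {0<..<s}. 1 + 1 / y j)"
    proof (rule prod.mono_neutral_cong_right)
      show "Pair r ` {0<..<s} \<subseteq> Y'"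
        using C mem_row[OF Y] by (auto simp: Y'_def)
      show "\<forall>x'\<in>Y' - Pair r ` {0<..<s}. (case x' of (i, j) \<Rightarrow> if i = r then 1 + 1 / y j else 1) = 1"
        using C mem_row[OF Y] by (force simp: Y'_def)
    qed (use fin in auto)
    then show ?thesis by (simp add: prod.reindex inj_on_def)
  qed
  have "hook_prod Y = real (hook Y r s) * (\<Prod>(i, j)\<in>Y'. real (hook Y i j))"
    unfolding hook_prod_def Y'_def using fin C by (subst prod.remove[of _ "(r, s)"]) auto
  also have "real (hook Y r s) = 1" using C by (simp add: hook_def)
  also have "(\<Prod>(i, j)\<in>Y'. real (hook Y i j)) = (\<Prod>(i, j)\<in>Y'. real (hook Y' i j) *
      ((if j = s then 1 + 1 / x i else 1) * (if i = r then 1 + 1 / y j else 1)))"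
    by (rule prod.cong) (use h in auto)
  also have "\<dots> = hook_prod Y' * ((\<Prod>(i, j)\<in>Y'. if j = s then 1 + 1 / x i else 1) *
      (\<Prod>(i, j)\<in>Y'. if i = r then 1 + 1 / y j else 1))"
    by (simp only: hook_prod_def prod.distrib[symmetric] case_prod_unfold)
  also have "\<dots> = hook_prod Y' * ((\<Prod>k\<in>{0<..<r}. 1 + 1 / x k) * (\<Prod>k\<in>{0<..<s}. 1 + 1 / y k))"
    by (simp only: px py)
  finally show ?thesis
    unfolding sum_hook_walk_corner[OF Y c] x_def y_def Y'_def by simp
qed

text \<open>Summing \<open>hook_prod_remove\<close> over the corners and exchanging the sums leaves
  mass 1 for each starting cell. Times \<open>fact (card Y - 1)\<close>, this is the branching rule
  of tableau counts for the hook quotient.\<close>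

lemma hook_prod_branching:
  assumes Y: "diagram Y"
  shows "(\<Sum>c\<in>corners Y. 1 / hook_prod (Y - {c})) = real (card Y) / hook_prod Y"
proof -
  have "1 / hook_prod (Y - {c}) = (\<Sum>(i, j)\<in>Y. hook_walk Y c i j) / hook_prod Y"
    if "c \<in> corners Y" for c
  proof -
    obtain r s where rs: "c = (r, s)" by fastforce
    define A where "A = (\<Sum>(i, j)\<in>Y. hook_walk Y c i j)"
    have "hook_prod Y = hook_prod (Y - {c}) * A"
      using hook_prod_remove[OF Y, of r s] that unfolding rs A_def by blast
    moreover from this have "A \<noteq> 0" using hook_prod_pos[of Y] by auto
    ultimately have "1 / hook_prod (Y - {c}) = A / hook_prod Y"
      using hook_prod_pos[of "Y - {c}"] by simp
    then show ?thesis unfolding A_def .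
  qed
  then have "(\<Sum>c\<in>corners Y. 1 / hook_prod (Y - {c})) =
      (\<Sum>c\<in>corners Y. (\<Sum>(i, j)\<in>Y. hook_walk Y c i j) / hook_prod Y)"
    by simp
  also have "\<dots> = (\<Sum>(i, j)\<in>Y. \<Sum>c\<in>corners Y. hook_walk Y c i j) / hook_prod Y"
    by (simp add: sum_divide_distrib[symmetric] sum.swap[of _ "corners Y"] case_prod_unfold)
  also have "(\<Sum>(i, j)\<in>Y. \<Sum>c\<in>corners Y. hook_walk Y c i j) = (\<Sum>(i, j)\<in>Y. 1)"
    by (rule sum.cong) (use sum_hook_walk[OF Y] in auto)
  also have "\<dots> = real (card Y)" by (simp add: case_prod_unfold)
  finally show ?thesis .
qed

text \<open>The counterpart of \<open>standard_tableaux\<close> for sets of cells, so that deleting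
  a corner is a set difference.\<close>

definition SYT :: "(nat \<times> nat) set \<Rightarrow> (nat \<times> nat \<Rightarrow> nat) set" where
  "SYT Y = {T \<in> extensional Y. bij_betw T Y {1..card Y} \<and>
     (\<forall>i j j'. (i, j) \<in> Y \<and> (i, j') \<in> Y \<and> j < j' \<longrightarrow> T (i, j) < T (i, j')) \<and>
     (\<forall>i i' j. (i, j) \<in> Y \<and> (i', j) \<in> Y \<and> i < i' \<longrightarrow> T (i, j) < T (i', j))}"

lemma finite_SYT:
  assumes "finite Y"
  shows "finite (SYT Y)"
proof (rule finite_subset)
  show "SYT Y \<subseteq> Y \<rightarrow>\<^sub>E {1..card Y}"
    by (auto simp: SYT_def PiE_def bij_betw_def)
  show "finite (Y \<rightarrow>\<^sub>E {1..card Y})" using assms by (intro finite_PiE) auto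
qed

text \<open>The largest entry is safe at a corner: no cell of \<open>Y\<close> lies to its right or
  below it.\<close>

lemma SYT_extend:
  assumes Y: "diagram Y" and c: "c \<in> corners Y" and T: "T \<in> SYT (Y - {c})"
  shows "T(c := card Y) \<in> SYT Y"
proof -
  obtain r s where rs: "c = (r, s)" by fastforce
  have cY: "c \<in> Y" using c rs by (auto simp: corners_def)
  have fin: "finite Y" by (rule finite_diagram[OF Y])
  define m where "m = card (Y - {c})"
  have n: "card Y = Suc m" unfolding m_def using card.remove[OF fin cY] .
  let ?T = "T(c := card Y)"
  have bij: "bij_betw T (Y - {c}) {1..m}"
    and ext: "T \<in> extensional (Y - {c})"
    and rows: "\<And>i j j'. (i, j) \<in> Y - {c} \<Longrightarrow> (i, j') \<in> Y - {c} \<Longrightarrow> j < j' \<Longrightarrow> T (i, j) < T (i, j')"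
    and cols: "\<And>i i' j. (i, j) \<in> Y - {c} \<Longrightarrow> (i', j) \<in> Y - {c} \<Longrightarrow> i < i' \<Longrightarrow> T (i, j) < T (i', j)"
    using T unfolding SYT_def m_def by blast+
  have lt: "T x < card Y" if "x \<in> Y - {c}" for x
    using bij_betwE[OF bij] that n by (metis atLeastAtMost_iff le_imp_less_Suc)
  have "bij_betw ?T (Y - {c}) {1..m}"
    using bij by (subst bij_betw_cong[of _ _ T]) auto
  moreover have "bij_betw ?T {c} {card Y}" by (simp add: bij_betw_def)
  ultimately have "bij_betw ?T (Y - {c} \<union> {c}) ({1..m} \<union> {card Y})"
    by (rule bij_betw_combine) (simp add: n)
  moreover have "Y - {c} \<union> {c} = Y" "{1..m} \<union> {card Y} = {1..card Y}"
    using cY unfolding n by auto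
  ultimately have "bij_betw ?T Y {1..card Y}" by (simp only:)
  moreover have "?T \<in> extensional Y" using ext cY by (auto simp: extensional_def)
  moreover have "?T (i, j) < ?T (i, j')" if "(i, j) \<in> Y" "(i, j') \<in> Y" "j < j'" for i j j'
  proof -
    have "(i, j) \<noteq> c" using corner_maximal[OF Y, of r s i j'] c rs that by auto
    then show ?thesis using rows lt that by auto
  qed
  moreover have "?T (i, j) < ?T (i', j)" if "(i, j) \<in> Y" "(i', j) \<in> Y" "i < i'" for i i' j
  proof -
    have "(i, j) \<noteq> c" using corner_maximal[OF Y, of r s i' j] c rs that by auto
    then show ?thesis using cols lt that by auto
  qed
  ultimately show ?thesis unfolding SYT_def by blast
qed

text \<open>The position of the largest entry \<open>card Y\<close> identifies the added corner, so
  extensions at different corners are disjoint.\<close>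

lemma SYT_branching:
  assumes Y: "diagram Y"
  shows "(\<Sum>c\<in>corners Y. card (SYT (Y - {c}))) \<le> card (SYT Y)"
proof -
  let ?E = "\<lambda>c. (\<lambda>T. T(c := card Y)) ` SYT (Y - {c})"
  have fin: "finite Y" by (rule finite_diagram[OF Y])
  have cY: "c \<in> Y" if "c \<in> corners Y" for c using that by (auto simp: corners_def)
  have "card (SYT (Y - {c})) = card (?E c)" for c
  proof (rule card_image[symmetric], rule inj_onI)
    fix T T' assume *: "T \<in> SYT (Y - {c})" "T' \<in> SYT (Y - {c})"
      and eq: "T(c := card Y) = T'(c := card Y)"
    have T: "T \<in> extensional (Y - {c})" "T' \<in> extensional (Y - {c})"
      using * unfolding SYT_def by blast+
    show "T = T'"
    proof
      fix x
      \<comment> \<open>At \<open>c\<close> both tableaux are \<open>undefined\<close> by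
        extensionality; elsewhere the updates change nothing.\<close>
      show "T x = T' x"
        using fun_cong[OF eq, of x] extensional_arb[OF T(1), of c] extensional_arb[OF T(2), of c]
        by (cases "x = c") simp_all
    qed
  qed
  then have "(\<Sum>c\<in>corners Y. card (SYT (Y - {c}))) = (\<Sum>c\<in>corners Y. card (?E c))" by simp
  also have "\<dots> = card (\<Union>c\<in>corners Y. ?E c)"
  proof (rule card_UN_disjoint[symmetric])
    show "finite (corners Y)" by (rule finite_corners[OF Y])
    show "\<forall>c\<in>corners Y. finite (?E c)" using fin by (simp add: finite_SYT)
    show "\<forall>c\<in>corners Y. \<forall>c'\<in>corners Y. c \<noteq> c' \<longrightarrow> ?E c \<inter> ?E c' = {}"
    proof (intro ballI impI)
      fix c c' assume c: "c \<in> corners Y" "c' \<in> corners Y" "c \<noteq> c'"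
      show "?E c \<inter> ?E c' = {}"
      proof (rule equals0I)
        fix U assume U: "U \<in> ?E c \<inter> ?E c'"
        then obtain T T' where "U = T(c := card Y)" "U = T'(c' := card Y)" by blast
        then have "U c = U c'" by (metis fun_upd_same)
        moreover have "U \<in> SYT Y" using U SYT_extend[OF Y c(1)] by blast
        then have "inj_on U Y" unfolding SYT_def bij_betw_def by blast
        ultimately show False using c cY by (meson inj_onD)
      qed
    qed
  qed
  also have "\<dots> \<le> card (SYT Y)"
    by (rule card_mono) (use finite_SYT[OF fin] SYT_extend[OF Y] in auto)
  finally show ?thesis .
qed

lemma SYT_empty: "card (SYT {}) = 1"
proof -
  have "SYT {} = {\<lambda>_. undefined}" by (auto simp: SYT_def bij_betw_def)
  then show ?thesis by simp
qed

text \<open>Both sides follow the branching recursion, the left one with equality by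
  \<open>hook_prod_branching\<close>, the right one with an inequality by
  \<open>SYT_branching\<close>.\<close>

lemma hook_length_bound:
  assumes "diagram Y"
  shows "fact (card Y) / hook_prod Y \<le> real (card (SYT Y))"
  using assms
proof (induction "card Y" arbitrary: Y)
  case 0
  then have "Y = {}" using finite_diagram by auto
  then show ?case using SYT_empty by (simp add: hook_prod_def)
next
  case (Suc n)
  note Y = Suc.prems
  have "fact n / hook_prod (Y - {c}) \<le> real (card (SYT (Y - {c})))" if "c \<in> corners Y" for c
  proof -
    have "card (Y - {c}) = n"
      using that Suc.hyps(2) finite_diagram[OF Y] by (auto simp: corners_def)
    then show ?thesis using Suc.hyps(1)[OF _ diagram_remove[OF Y that]] by auto
  qed
  then have "(\<Sum>c\<in>corners Y. fact n / hook_prod (Y - {c})) \<le>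
      (\<Sum>c\<in>corners Y. real (card (SYT (Y - {c}))))"
    by (rule sum_mono)
  also have "\<dots> \<le> real (card (SYT Y))"
    using SYT_branching[OF Y] by (simp flip: of_nat_sum)
  also have "(\<Sum>c\<in>corners Y. fact n / hook_prod (Y - {c})) =
      fact n * (\<Sum>c\<in>corners Y. 1 / hook_prod (Y - {c}))"
    by (simp add: sum_distrib_left)
  finally show ?case
    unfolding hook_prod_branching[OF Y] Suc.hyps(2)[symmetric] by (simp add: algebra_simps)
qed

section \<open>Comparison of the virtual degree with the hook product\<close>

text \<open>With \<open>m = q + t - j + 1\<close> the factors are \<open>(x + m) / m\<close> for
  \<open>m\<close> from 1 to \<open>t\<close>. The induction peels off the largest \<open>m\<close>
  and shifts the offset \<open>q\<close>.\<close>

lemma prod_shifted_choose: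
  "(\<Prod>j\<in>{q<..q + t}. 1 + real x / real (q + t - j + 1)) = real ((x + t) choose t)"
proof (induction t arbitrary: q)
  case (Suc t)
  have "{q<..q + Suc t} = insert (Suc q) {Suc q<..Suc q + t}" by auto
  then have "(\<Prod>j\<in>{q<..q + Suc t}. 1 + real x / real (q + Suc t - j + 1)) =
      (1 + real x / real (Suc t)) * (\<Prod>j\<in>{Suc q<..Suc q + t}. 1 + real x / real (Suc q + t - j + 1))"
    by simp
  also have "\<dots> = (1 + real x / real (Suc t)) * real ((x + t) choose t)"
    by (simp only: Suc.IH)
  also have "\<dots> = real ((x + Suc t) choose Suc t)"
  proof -
    have "real (Suc t) * real ((x + Suc t) choose Suc t) = real (x + Suc t) * real ((x + t) choose t)"
      using arg_cong[OF Suc_times_binomial[of t "x + t"], of real]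
      by (simp only: of_nat_mult add_Suc_right)
    then show ?thesis by (simp add: field_simps del: binomial_Suc_Suc)
  qed
  finally show ?case .
qed simp

lemma prod_shifted_fact: "(\<Prod>j\<in>{q<..q + t}. real (q + t - j + 1)) = fact t"
proof (induction t arbitrary: q)
  case (Suc t)
  have "{q<..q + Suc t} = insert (Suc q) {Suc q<..Suc q + t}" by auto
  then have "(\<Prod>j\<in>{q<..q + Suc t}. real (q + Suc t - j + 1)) =
      real (Suc t) * (\<Prod>j\<in>{Suc q<..Suc q + t}. real (Suc q + t - j + 1))"
    by simp
  also have "\<dots> = real (Suc t) * fact t" by (simp only: Suc.IH)
  finally show ?case by simp
qed simp

text \<open>A single term of the exponential series. It does the work of Stirling's formula:
  \<open>fact m\<close> is at least \<open>(m / e) ^ m\<close>.\<close>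

lemma power_div_fact_le_exp:
  fixes x :: real
  assumes "0 \<le> x"
  shows "x ^ m / fact m \<le> exp x"
proof -
  have s: "summable (\<lambda>k. x ^ k /\<^sub>R fact k)" by (rule summable_exp_generic)
  have "(\<Sum>k\<in>{m}. x ^ k /\<^sub>R fact k) \<le> (\<Sum>k. x ^ k /\<^sub>R fact k)"
    by (rule sum_le_suminf[OF s]) (use assms in auto)
  then show ?thesis by (simp add: exp_def divide_inverse mult.commute)
qed

section \<open>The Durfee square and the row ratios\<close>

definition durfee :: "(nat \<times> nat) set \<Rightarrow> nat" where
  "durfee Y = card {i. (i, i) \<in> Y}"

lemma mem_diag:
  assumes Y: "diagram Y"
  shows "(i, i) \<in> Y \<longleftrightarrow> 1 \<le> i \<and> i \<le> durfee Y"
proof -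
  have "finite {i. (i, i) \<in> Y}"
    using finite_diagram[OF Y] by (rule finite_subset[rotated, OF finite_imageI[of _ fst]]) force
  then have "{i. (i, i) \<in> Y} = {1..durfee Y}"
    unfolding durfee_def
    by (rule down_set_eq) (use diagram_pos[OF Y] diagram_down[OF Y] in blast)+
  then show ?thesis by (auto simp: set_eq_iff)
qed

lemma durfee_conjugate [simp]: "durfee (conjugate Y) = durfee Y"
  by (simp add: durfee_def)

lemma durfee_square:
  assumes Y: "diagram Y" and "1 \<le> i" "i \<le> durfee Y" "1 \<le> j" "j \<le> durfee Y"
  shows "(i, j) \<in> Y"
proof (rule diagram_down[OF Y])
  show "(durfee Y, durfee Y) \<in> Y" using assms mem_diag[OF Y] by auto
qed (use assms in auto)

lemma durfee_le_row:
  assumes "diagram Y" "1 \<le> i" "i \<le> durfee Y"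
  shows "durfee Y \<le> row Y i"
  using row_ge[OF assms(1) durfee_square[OF assms, of "durfee Y"]] assms by auto

lemma durfee_le_col:
  assumes "diagram Y" "1 \<le> i" "i \<le> durfee Y"
  shows "durfee Y \<le> col Y i"
  using durfee_le_row[OF diagram_conjugate[OF assms(1)], of i] assms by simp

lemma col_le_durfee:
  assumes Y: "diagram Y" and j: "durfee Y < j"
  shows "col Y j \<le> durfee Y"
proof (rule ccontr)
  assume "\<not> col Y j \<le> durfee Y"
  then have "(Suc (durfee Y), j) \<in> Y" using mem_col[OF Y] by auto
  then have "(Suc (durfee Y), Suc (durfee Y)) \<in> Y"
    using diagram_down[OF Y, of "Suc (durfee Y)" j] j by auto
  then show False using mem_diag[OF Y] by auto
qed

text \<open>
  The denominators are the arm lengths plus one. Their product over \<open>i < j \<le> row Y i\<close> is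
  \<open>fact (row Y i - i)\<close>, which is how the factorials of the virtual degree enter.
\<close>

definition row_ratio :: "(nat \<times> nat) set \<Rightarrow> nat \<Rightarrow> real" where
  "row_ratio Y i = (\<Prod>j\<in>{i<..row Y i}. real (hook Y i j) / real (row Y i - j + 1))"

lemma row_ratio_pos: "0 < row_ratio Y i"
  unfolding row_ratio_def by (rule prod_pos) (auto simp: hook_def)

lemma binomial_mono_diagonal: "n choose m \<le> (n + t) choose (m + t)"
proof (induction t)
  case (Suc t)
  have "(n + t) choose (m + t) \<le> (n + Suc t) choose (m + Suc t)" by simp
  then show ?case using Suc by (rule order_trans[rotated])
qed simp

text \<open>With \<open>A = row Y i - i\<close> the hook is \<open>A + 1 + (col Y j - j)\<close>, so
  the quotient is \<open>(A + 1) / (A + 1 - (j - i))\<close> times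
  \<open>1 + (col Y j - j) / (A + 1)\<close>. Neither factor increases with \<open>A\<close>, so
  \<open>A\<close> may be lowered to \<open>m = durfee Y - i\<close>; the first factors then
  multiply to \<open>(m + 1) ^ m / fact m\<close>.\<close>

lemma row_ratio_square_le:
  assumes Y: "diagram Y" and i: "1 \<le> i" "i \<le> durfee Y"
  shows "(\<Prod>j\<in>{i<..durfee Y}. real (hook Y i j) / real (row Y i - j + 1)) \<le>
    exp (real (durfee Y)) * (\<Prod>j\<in>{i<..durfee Y}. 1 + real (col Y j - j) / real (durfee Y - i + 1))"
proof -
  let ?d = "durfee Y"
  define m where "m = ?d - i"
  have m: "?d = i + m" using i by (simp add: m_def)
  have "(\<Prod>j\<in>{i<..?d}. real (hook Y i j) / real (row Y i - j + 1)) \<le>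
      (\<Prod>j\<in>{i<..?d}. (real (m + 1) / real (i + m - j + 1)) * (1 + real (col Y j - j) / real (m + 1)))"
  proof (rule prod_mono, safe)
    fix j assume j: "j \<in> {i<..?d}"
    define A where "A = row Y i - i"
    have Am: "m \<le> A" using durfee_le_row[OF Y i] by (simp add: A_def m)
    have rowA: "row Y i = A + i" using durfee_le_row[OF Y i] i by (simp add: A_def)
    have cj: "j \<le> col Y j" using durfee_le_col[OF Y, of j] i j by auto
    have h: "real (hook Y i j) = real (A + 1) * (1 + real (col Y j - j) / real (A + 1))"
      using j i cj Am m by (simp add: hook_def rowA field_simps of_nat_diff)
    have r: "row Y i - j + 1 = A + 1 - (j - i)" unfolding rowA using j Am m by auto
    have "real (A + 1) / real (A + 1 - (j - i)) \<le> real (m + 1) / real (i + m - j + 1)"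
    proof -
      have 1: "real (A + 1 - (j - i)) = real A + 1 - (real j - real i)"
        "real (i + m - j + 1) = real i + real m - real j + 1"
        using j Am m by (auto simp: of_nat_diff)
      \<comment> \<open>After cross-multiplication the claimed inequality is the sign of this
        product.\<close>
      have "(real j - real i) * (real A - real m) \<ge> 0" using j Am by simp
      moreover have "real j - real i \<le> real m" "real m \<le> real A" using j Am m by auto
      ultimately show ?thesis unfolding 1 by (simp add: divide_simps) (simp add: algebra_simps)
    qed
    moreover have "real (col Y j - j) / real (A + 1) \<le> real (col Y j - j) / real (m + 1)"
      using Am by (intro divide_left_mono) auto
    ultimately have "(real (A + 1) / real (A + 1 - (j - i))) * (1 + real (col Y j - j) / real (A + 1))
        \<le> (real (m + 1) / real (i + m - j + 1)) * (1 + real (col Y j - j) / real (m + 1))"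
      by (intro mult_mono) auto
    then show "real (hook Y i j) / real (row Y i - j + 1) \<le>
        (real (m + 1) / real (i + m - j + 1)) * (1 + real (col Y j - j) / real (m + 1))"
      unfolding h r by (simp add: field_simps)
  qed simp
  also have "\<dots> = (\<Prod>j\<in>{i<..?d}. real (m + 1) / real (i + m - j + 1)) *
      (\<Prod>j\<in>{i<..?d}. 1 + real (col Y j - j) / real (m + 1))"
    by (rule prod.distrib)
  also have "(\<Prod>j\<in>{i<..?d}. real (m + 1) / real (i + m - j + 1)) = real (m + 1) ^ m / fact m"
    unfolding m prod_dividef prod_shifted_fact by simp
  also have "\<dots> * (\<Prod>j\<in>{i<..?d}. 1 + real (col Y j - j) / real (m + 1)) \<le>
      exp (real ?d) * (\<Prod>j\<in>{i<..?d}. 1 + real (col Y j - j) / real (m + 1))"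
  proof (rule mult_right_mono)
    have "real (m + 1) ^ m / fact m \<le> exp (real (m + 1))"
      by (rule power_div_fact_le_exp) simp
    also have "\<dots> \<le> exp (real ?d)" using m i by simp
    finally show "real (m + 1) ^ m / fact m \<le> exp (real ?d)" .
  qed (simp add: prod_nonneg)
  finally show ?thesis unfolding m_def .
qed

text \<open>
  To the right of the Durfee square the leg lengths in row \<open>i\<close> are at most \<open>durfee Y - i\<close>, so the
  product telescopes to a binomial coefficient.
\<close>

lemma row_ratio_tail_le:
  assumes Y: "diagram Y" and i: "1 \<le> i" "i \<le> durfee Y"
  shows "(\<Prod>j\<in>{durfee Y<..row Y i}. real (hook Y i j) / real (row Y i - j + 1)) \<le>
    real ((row Y i - i + durfee Y) choose durfee Y)"
proof -
  let ?d = "durfee Y"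
  define t where "t = row Y i - ?d"
  have t: "row Y i = ?d + t" using durfee_le_row[OF Y i] by (simp add: t_def)
  have "(\<Prod>j\<in>{?d<..row Y i}. real (hook Y i j) / real (row Y i - j + 1)) \<le>
      (\<Prod>j\<in>{?d<..?d + t}. 1 + real (?d - i) / real (?d + t - j + 1))"
    unfolding t
  proof (rule prod_mono, safe)
    fix j assume j: "j \<in> {?d<..?d + t}"
    have "hook Y i j \<le> (?d + t - j + 1) + (?d - i)"
      using col_le_durfee[OF Y, of j] j by (auto simp: hook_def t)
    then have "real (hook Y i j) \<le> real (?d + t - j + 1) + real (?d - i)"
      unfolding of_nat_add[symmetric] of_nat_le_iff .
    then show "real (hook Y i j) / real (?d + t - j + 1) \<le> 1 + real (?d - i) / real (?d + t - j + 1)"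
      by (simp add: divide_simps)
  qed simp
  also have "\<dots> = real ((?d - i + t) choose t)" by (rule prod_shifted_choose)
  also have "(?d - i + t) choose t = (?d - i + t) choose (?d - i)"
    using binomial_symmetric[of t "?d - i + t"] by simp
  \<comment> \<open>The lower index is raised to \<open>durfee Y\<close>, the same for all rows, so
    that the cost depends on the coordinate \<open>row Y i - i\<close> alone.\<close>
  also have "real \<dots> \<le> real ((?d - i + t + i) choose (?d - i + i))"
    unfolding of_nat_le_iff by (rule binomial_mono_diagonal)
  also have "\<dots> \<le> real ((row Y i - i + ?d) choose ?d)"
    using i t by (auto intro!: binomial_right_mono)
  finally show ?thesis .
qed

lemma row_ratio_le:
  assumes Y: "diagram Y" and i: "1 \<le> i" "i \<le> durfee Y"
  shows "row_ratio Y i \<le> exp (real (durfee Y)) *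
    (\<Prod>j\<in>{i<..durfee Y}. 1 + real (col Y j - j) / real (durfee Y - i + 1)) *
    real ((row Y i - i + durfee Y) choose durfee Y)"
proof -
  have "{i<..row Y i} = {i<..durfee Y} \<union> {durfee Y<..row Y i}"
    using i durfee_le_row[OF Y i] by auto
  then have "row_ratio Y i = (\<Prod>j\<in>{i<..durfee Y}. real (hook Y i j) / real (row Y i - j + 1)) *
      (\<Prod>j\<in>{durfee Y<..row Y i}. real (hook Y i j) / real (row Y i - j + 1))"
    unfolding row_ratio_def by (simp only:) (rule prod.union_disjoint, auto)
  also have "\<dots> \<le> (exp (real (durfee Y)) *
      (\<Prod>j\<in>{i<..durfee Y}. 1 + real (col Y j - j) / real (durfee Y - i + 1))) *
      real ((row Y i - i + durfee Y) choose durfee Y)"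
    by (rule mult_mono[OF row_ratio_square_le[OF assms] row_ratio_tail_le[OF assms]])
      (intro mult_nonneg_nonneg prod_nonneg; simp)+
  finally show ?thesis .
qed

lemma diagram_rows:
  assumes Y: "diagram Y"
  shows "Y = (SIGMA i:{1..col Y 1}. {1..row Y i})"
proof (intro equalityI subsetI)
  fix c assume c: "c \<in> Y"
  obtain i j where ij: "c = (i, j)" by fastforce
  then have "(i, 1) \<in> Y" using diagram_down[OF Y, of i j i 1] diagram_pos[OF Y, of i j] c by auto
  then show "c \<in> (SIGMA i:{1..col Y 1}. {1..row Y i})"
    using c ij mem_col[OF Y, of i 1] mem_row[OF Y, of i j] by auto
next
  fix c assume "c \<in> (SIGMA i:{1..col Y 1}. {1..row Y i})"
  then show "c \<in> Y" using mem_row[OF Y] by auto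
qed

lemma card_diagram_rows:
  assumes Y: "diagram Y"
  shows "card Y = (\<Sum>i\<in>{1..col Y 1}. row Y i)"
  by (subst diagram_rows[OF Y]) simp

text \<open>Every denominator is at least 1, so a factor is at most
  \<open>1 + (col Y j - 1)\<close>, hence at most \<open>exp (col Y j - 1)\<close>; these exponents
  count cells outside the first row.\<close>

lemma row_ratio_first_le:
  assumes Y: "diagram Y"
  shows "row_ratio Y 1 \<le> exp (real (card Y - row Y 1))"
proof -
  have pos: "1 \<le> col Y j" if "j \<in> {1..row Y 1}" for j
    using that mem_row[OF Y, of 1 j] mem_col[OF Y, of 1 j] by auto
  have "row_ratio Y 1 \<le> (\<Prod>j\<in>{1<..row Y 1}. exp (real (col Y j - 1)))"
    unfolding row_ratio_def
  proof (rule prod_mono, safe)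
    fix j assume j: "j \<in> {1<..row Y 1}"
    have "real (hook Y 1 j) / real (row Y 1 - j + 1) = 1 + real (col Y j - 1) / real (row Y 1 - j + 1)"
      by (simp add: hook_def field_simps)
    also have "\<dots> \<le> 1 + real (col Y j - 1) / 1"
      by (intro add_left_mono divide_left_mono) auto
    also have "\<dots> \<le> exp (real (col Y j - 1))" using exp_ge_add_one_self[of "real (col Y j - 1)"] by simp
    finally show "real (hook Y 1 j) / real (row Y 1 - j + 1) \<le> exp (real (col Y j - 1))" .
  qed simp
  also have "\<dots> = exp (real (\<Sum>j\<in>{1<..row Y 1}. col Y j - 1))"
    by (simp add: exp_sum)
  also have "(\<Sum>j\<in>{1<..row Y 1}. col Y j - 1) \<le> (\<Sum>j\<in>{1..row Y 1}. col Y j - 1)"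
    by (rule sum_mono2) auto
  also have "(\<Sum>j\<in>{1..row Y 1}. col Y j - 1) = card Y - row Y 1"
  proof -
    have "card Y = (\<Sum>j\<in>{1..row Y 1}. col Y j)"
      using card_diagram_rows[OF diagram_conjugate[OF Y]] by simp
    also have "\<dots> = (\<Sum>j\<in>{1..row Y 1}. Suc (col Y j - 1))"
        proof (rule sum.cong)
      show "col Y j = Suc (col Y j - 1)" if "j \<in> {1..row Y 1}" for j
        using pos[OF that] by simp
    qed simp
    also have "\<dots> = (\<Sum>j\<in>{1..row Y 1}. col Y j - 1) + row Y 1" by (simp add: sum_Suc)
    finally show ?thesis by simp
  qed
  finally show ?thesis by simp
qed

section \<open>Splitting a diagram along its diagonal\<close>

definition above_diag :: "(nat \<times> nat) set \<Rightarrow> (nat \<times> nat) set" where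
  "above_diag Y = (SIGMA i:{1..durfee Y}. {i<..row Y i})"

lemma above_diag_eq:
  assumes Y: "diagram Y"
  shows "above_diag Y = {(i, j). (i, j) \<in> Y \<and> i < j}"
proof (intro equalityI subsetI)
  fix c assume "c \<in> above_diag Y"
  then show "c \<in> {(i, j). (i, j) \<in> Y \<and> i < j}"
    using mem_row[OF Y] by (auto simp: above_diag_def)
next
  fix c assume c: "c \<in> {(i, j). (i, j) \<in> Y \<and> i < j}"
  obtain i j where ij: "c = (i, j)" by fastforce
  have "(i, i) \<in> Y"
    using diagram_down[OF Y, of i j i i] diagram_pos[OF Y, of i j] c ij by auto
  then show "c \<in> above_diag Y"
    using c ij mem_diag[OF Y, of i] row_ge[OF Y, of i j] by (auto simp: above_diag_def)
qed

lemma diagram_split: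
  assumes Y: "diagram Y"
  shows "Y = (\<lambda>i. (i, i)) ` {1..durfee Y} \<union> above_diag Y \<union> conjugate (above_diag (conjugate Y))"
proof -
  have "c \<in> Y \<longleftrightarrow> c \<in> (\<lambda>i. (i, i)) ` {1..durfee Y} \<union> above_diag Y \<union> conjugate (above_diag (conjugate Y))"
    for c
  proof (cases c)
    case (Pair i j)
    then show ?thesis
      using mem_diag[OF Y, of i]
      by (cases i j rule: linorder_cases)
        (auto simp: above_diag_eq[OF Y] above_diag_eq[OF diagram_conjugate[OF Y]])
  qed
  then show ?thesis by blast
qed

lemma finite_above_diag: "finite (above_diag Y)"
  by (simp add: above_diag_def)

lemma prod_conjugate:
  "(\<Prod>(i, j)\<in>conjugate A. f i j) = (\<Prod>(j, i)\<in>A. f i j)"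
  unfolding conjugate_def by (subst prod.reindex) (auto simp: case_prod_unfold)

lemma prod_diagram_split:
  fixes f :: "nat \<Rightarrow> nat \<Rightarrow> 'b::comm_monoid_mult"
  assumes Y: "diagram Y"
  shows "(\<Prod>(i, j)\<in>Y. f i j) = (\<Prod>i\<in>{1..durfee Y}. f i i) *
    (\<Prod>i\<in>{1..durfee Y}. \<Prod>j\<in>{i<..row Y i}. f i j) *
    (\<Prod>j\<in>{1..durfee Y}. \<Prod>i\<in>{j<..col Y j}. f i j)"
proof -
  let ?D = "(\<lambda>i. (i, i)) ` {1..durfee Y}"
  let ?B = "conjugate (above_diag (conjugate Y))"
  note Y' = diagram_conjugate[OF Y]
  have fin: "finite ?D" "finite (above_diag Y)" "finite ?B"
    by (auto simp: finite_above_diag conjugate_def)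
  have "(\<Prod>(i, j)\<in>Y. f i j) = (\<Prod>(i, j)\<in>?D \<union> above_diag Y \<union> ?B. f i j)"
    using diagram_split[OF Y] by simp
  also have "\<dots> = (\<Prod>(i, j)\<in>?D \<union> above_diag Y. f i j) * (\<Prod>(i, j)\<in>?B. f i j)"
    by (rule prod.union_disjoint)
      (use fin in \<open>auto simp: above_diag_eq[OF Y] above_diag_eq[OF Y']\<close>)
  also have "(\<Prod>(i, j)\<in>?D \<union> above_diag Y. f i j) = (\<Prod>(i, j)\<in>?D. f i j) * (\<Prod>(i, j)\<in>above_diag Y. f i j)"
    by (rule prod.union_disjoint)
      (use fin in \<open>auto simp: above_diag_eq[OF Y]\<close>)
  also have "(\<Prod>(i, j)\<in>?D. f i j) = (\<Prod>i\<in>{1..durfee Y}. f i i)"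
    by (subst prod.reindex) (auto simp: inj_on_def)
  also have "(\<Prod>(i, j)\<in>above_diag Y. f i j) = (\<Prod>i\<in>{1..durfee Y}. \<Prod>j\<in>{i<..row Y i}. f i j)"
    unfolding above_diag_def by (subst prod.Sigma) auto
  also have "(\<Prod>(i, j)\<in>?B. f i j) = (\<Prod>j\<in>{1..durfee Y}. \<Prod>i\<in>{j<..col Y j}. f i j)"
    unfolding prod_conjugate unfolding above_diag_def by (subst prod.Sigma) auto
  finally show ?thesis .
qed

lemma card_diagram_split:
  assumes Y: "diagram Y"
  shows "card Y = (\<Sum>i\<in>{1..durfee Y}. (row Y i - i) + (col Y i - i)) + durfee Y"
proof -
  let ?D = "(\<lambda>i. (i, i)) ` {1..durfee Y}"
  let ?B = "conjugate (above_diag (conjugate Y))"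
  note Y' = diagram_conjugate[OF Y]
  have fin: "finite ?D" "finite (above_diag Y)" "finite ?B"
    by (auto simp: finite_above_diag conjugate_def)
  have "card Y = card (?D \<union> above_diag Y \<union> ?B)"
    using diagram_split[OF Y] by simp
  also have "\<dots> = card (?D \<union> above_diag Y) + card ?B"
    by (rule card_Un_disjoint)
      (use fin in \<open>auto simp: above_diag_eq[OF Y] above_diag_eq[OF Y']\<close>)
  also have "card (?D \<union> above_diag Y) = card ?D + card (above_diag Y)"
    by (rule card_Un_disjoint)
      (use fin in \<open>auto simp: above_diag_eq[OF Y]\<close>)
  also have "card ?D = durfee Y"
    by (subst card_image) (auto simp: inj_on_def)
  finally show ?thesis by (simp add: above_diag_def sum.distrib)
qed

text \<open>The virtual degree in terms of cells; \<open>row Y i - i\<close> and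
  \<open>col Y i - i\<close> are the Frobenius coordinates.\<close>

definition frobenius_degree :: "(nat \<times> nat) set \<Rightarrow> real" where
  "frobenius_degree Y = fact (card Y - 1) /
     (\<Prod>i\<in>{1..durfee Y}. fact (row Y i - i) * fact (col Y i - i))"

lemma fact_eq_row_prod:
  assumes "i \<le> row Y i"
  shows "(\<Prod>j\<in>{i<..row Y i}. real (row Y i - j + 1)) = fact (row Y i - i)"
  using prod_shifted_fact[of i "row Y i - i"] assms by simp

lemma row_prod_eq:
  assumes "i \<le> row Y i"
  shows "(\<Prod>j\<in>{i<..row Y i}. real (hook Y i j)) = row_ratio Y i * fact (row Y i - i)"
proof -
  have "row_ratio Y i * (\<Prod>j\<in>{i<..row Y i}. real (row Y i - j + 1)) =
      (\<Prod>j\<in>{i<..row Y i}. real (hook Y i j))"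
    unfolding row_ratio_def prod.distrib[symmetric] by (rule prod.cong) auto
  then show ?thesis using fact_eq_row_prod[OF assms] by simp
qed

lemma hook_conjugate: "hook (conjugate Y) j i = hook Y i j"
  by (simp add: hook_def)

lemma hook_prod_eq:
  assumes Y: "diagram Y"
  shows "hook_prod Y = (\<Prod>i\<in>{1..durfee Y}. real (hook Y i i)) *
    (\<Prod>i\<in>{1..durfee Y}. row_ratio Y i) * (\<Prod>i\<in>{1..durfee Y}. row_ratio (conjugate Y) i) *
    (\<Prod>i\<in>{1..durfee Y}. fact (row Y i - i) * fact (col Y i - i))"
proof -
  note Y' = diagram_conjugate[OF Y]
  have "(\<Prod>j\<in>{i<..row Y i}. real (hook Y i j)) = row_ratio Y i * fact (row Y i - i)"
    if "i \<in> {1..durfee Y}" for i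
    using row_prod_eq[of i Y] durfee_le_row[OF Y, of i] that by auto
  moreover have "(\<Prod>i\<in>{j<..col Y j}. real (hook Y i j)) = row_ratio (conjugate Y) j * fact (col Y j - j)"
    if "j \<in> {1..durfee Y}" for j
    using row_prod_eq[of j "conjugate Y"] durfee_le_row[OF Y', of j] that by (auto simp: hook_conjugate)
  ultimately show ?thesis
    unfolding hook_prod_def prod_diagram_split[OF Y] by (simp add: prod.distrib)
qed

text \<open>The value that the hook length formula assigns to the number of tableaux;
  \<open>hook_length_bound\<close> makes it a lower bound.\<close>

definition hook_degree :: "(nat \<times> nat) set \<Rightarrow> real" where
  "hook_degree Y = fact (card Y) / hook_prod Y"

lemma hook_degree_pos: "0 < hook_degree Y"
  by (simp add: hook_degree_def hook_prod_pos)

lemma hook_degree_conjugate [simp]: "hook_degree (conjugate Y) = hook_degree Y"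
  by (simp add: hook_degree_def hook_prod_def prod_conjugate hook_conjugate)

lemma frobenius_degree_conjugate [simp]: "frobenius_degree (conjugate Y) = frobenius_degree Y"
  by (simp add: frobenius_degree_def mult.commute)

text \<open>
  The cost in \<open>ln (frobenius_degree Y / hook_degree Y)\<close> of a Frobenius coordinate \<open>p\<close>. It is at most
  \<open>p + durfee Y\<close>, which is efficient for small \<open>p\<close>, and at most \<open>durfee Y * ln (p + 1)\<close>,
  which is efficient for large \<open>p\<close>.
\<close>

definition ln_choose :: "(nat \<times> nat) set \<Rightarrow> nat \<Rightarrow> real" where
  "ln_choose Y p = ln (real ((p + durfee Y) choose durfee Y))"

lemma ln_choose_conjugate [simp]: "ln_choose (conjugate Y) = ln_choose Y"
  by (simp add: ln_choose_def fun_eq_iff)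

section \<open>Upper bounds for the logarithm of virtual degree over hook degree\<close>

lemma ln_row_ratio_le:
  assumes Y: "diagram Y" and i: "1 \<le> i" "i \<le> durfee Y"
  shows "ln (row_ratio Y i) \<le> real (durfee Y) +
    (\<Sum>j\<in>{i<..durfee Y}. ln (1 + real (col Y j - j) / real (durfee Y - i + 1))) +
    ln_choose Y (row Y i - i)"
proof -
  let ?P = "\<Prod>j\<in>{i<..durfee Y}. 1 + real (col Y j - j) / real (durfee Y - i + 1)"
  have pos: "1 + real (col Y j - j) / real (durfee Y - i + 1) > 0" for j
    by (simp add: add_pos_nonneg)
  have "ln (row_ratio Y i) \<le> ln (exp (real (durfee Y)) * ?P * real ((row Y i - i + durfee Y) choose durfee Y))"
    using row_ratio_le[OF assms] row_ratio_pos[of Y i] by simp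
  also have "\<dots> = real (durfee Y) + ln ?P + ln_choose Y (row Y i - i)"
  proof -
    have "?P > 0" using pos by (intro prod_pos) blast
    moreover have "real ((row Y i - i + durfee Y) choose durfee Y) > 0" by simp
    moreover have "ln (x * y * z) = ln x + ln y + ln z" if "0 < x" "0 < y" "0 < z" for x y z :: real
      using that by (simp add: ln_mult_pos)
    ultimately show ?thesis unfolding ln_choose_def by (simp only: exp_gt_zero ln_exp)
  qed
  also have "ln ?P = (\<Sum>j\<in>{i<..durfee Y}. ln (1 + real (col Y j - j) / real (durfee Y - i + 1)))"
    by (rule ln_prod, simp, rule less_imp_neq[symmetric], rule pos)
  finally show ?thesis .
qed

text \<open>Once the sums are exchanged and \<open>i < j\<close> is dropped, the terms of a fixed
  \<open>j\<close> form the logarithm of a full binomial coefficient, by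
  \<open>prod_shifted_choose\<close>. As \<open>i < j\<close> forces \<open>j\<close> to be at least
  2, the first column is spared; for the conjugate diagram this spares the first row.\<close>

lemma cross_sum_le:
  assumes Y: "diagram Y"
  shows "(\<Sum>i\<in>{1..durfee Y}. \<Sum>j\<in>{i<..durfee Y}. ln (1 + real (col Y j - j) / real (durfee Y - i + 1)))
    \<le> (\<Sum>j\<in>{2..durfee Y}. ln_choose Y (col Y j - j))"
proof -
  let ?d = "durfee Y"
  let ?f = "\<lambda>i j. ln (1 + real (col Y j - j) / real (?d - i + 1))"
  have "(\<Sum>i\<in>{1..?d}. \<Sum>j\<in>{i<..?d}. ?f i j) = (\<Sum>i\<in>{1..?d}. \<Sum>j\<in>{2..?d}. if i < j then ?f i j else 0)"
  proof (rule sum.cong[OF refl])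
    fix i assume "i \<in> {1..?d}"
    then show "(\<Sum>j\<in>{i<..?d}. ?f i j) = (\<Sum>j\<in>{2..?d}. if i < j then ?f i j else 0)"
      by (intro sum.mono_neutral_cong_left) auto
  qed
  also have "\<dots> = (\<Sum>j\<in>{2..?d}. \<Sum>i\<in>{1..?d}. if i < j then ?f i j else 0)"
    by (rule sum.swap)
  also have "\<dots> \<le> (\<Sum>j\<in>{2..?d}. \<Sum>i\<in>{1..?d}. ?f i j)"
    by (intro sum_mono) auto
  also have "\<dots> = (\<Sum>j\<in>{2..?d}. ln_choose Y (col Y j - j))"
  proof (rule sum.cong[OF refl])
    fix j
    have pos: "1 + real (col Y j - j) / real (?d - i + 1) > 0" for i
      by (simp add: add_pos_nonneg)
    have "(\<Sum>i\<in>{1..?d}. ?f i j) = ln (\<Prod>i\<in>{1..?d}. 1 + real (col Y j - j) / real (?d - i + 1))"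
      by (rule ln_prod[symmetric], simp, rule less_imp_neq[symmetric], rule pos)
    also have "(\<Prod>i\<in>{1..?d}. 1 + real (col Y j - j) / real (?d - i + 1)) =
        real ((col Y j - j + ?d) choose ?d)"
    proof -
      have "{1..?d} = {0<..?d}" by auto
      then show ?thesis
        using prod_shifted_choose[where q = 0 and t = ?d and x = "col Y j - j"] by (simp only: add_0)
    qed
    finally show "(\<Sum>i\<in>{1..?d}. ?f i j) = ln_choose Y (col Y j - j)"
      by (simp only: ln_choose_def)
  qed
  finally show ?thesis .
qed

lemma ln_row_ratio_sum_le:
  assumes Y: "diagram Y" and I: "I \<subseteq> {1..durfee Y}"
  shows "(\<Sum>i\<in>I. ln (row_ratio Y i)) \<le> real (durfee Y) ^ 2 +
    (\<Sum>j\<in>{2..durfee Y}. ln_choose Y (col Y j - j)) + (\<Sum>i\<in>I. ln_choose Y (row Y i - i))"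
proof -
  let ?d = "durfee Y"
  let ?f = "\<lambda>i. \<Sum>j\<in>{i<..?d}. ln (1 + real (col Y j - j) / real (?d - i + 1))"
  have f0: "?f i \<ge> 0" for i by (rule sum_nonneg) auto
  have "(\<Sum>i\<in>I. ln (row_ratio Y i)) \<le> (\<Sum>i\<in>I. real ?d + ?f i + ln_choose Y (row Y i - i))"
    by (rule sum_mono) (use ln_row_ratio_le[OF Y] I in force)
  also have "\<dots> = real (card I) * real ?d + (\<Sum>i\<in>I. ?f i) + (\<Sum>i\<in>I. ln_choose Y (row Y i - i))"
    by (simp add: sum.distrib)
  also have "real (card I) * real ?d \<le> real ?d * real ?d"
    using card_mono[OF _ I] by (intro mult_right_mono) auto
  also have "(\<Sum>i\<in>I. ?f i) \<le> (\<Sum>i\<in>{1..?d}. ?f i)"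
    by (rule sum_mono2) (use I f0 in auto)
  also note cross_sum_le[OF Y]
  finally show ?thesis by (simp add: power2_eq_square)
qed

text \<open>The hook is \<open>a + b + 1\<close>, at most \<open>(a + 1) * (b + 1)\<close>, and
  \<open>p + 1 = (p + 1) choose 1\<close> grows along the diagonal of Pascal's triangle to
  \<open>(p + durfee Y) choose durfee Y\<close>.\<close>

lemma ln_hook_diag_le:
  assumes Y: "diagram Y" and i: "1 \<le> i" "i \<le> durfee Y"
  shows "ln (real (hook Y i i)) \<le> ln_choose Y (row Y i - i) + ln_choose Y (col Y i - i)"
proof -
  have c: "real (p + 1) \<le> real ((p + durfee Y) choose durfee Y)" for p
  proof -
    have "durfee Y = 1 + (durfee Y - 1)" "p + durfee Y = p + 1 + (durfee Y - 1)" using i by auto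
    then have "(p + 1) choose 1 \<le> (p + durfee Y) choose durfee Y"
      using binomial_mono_diagonal[of "p + 1" 1 "durfee Y - 1"] by simp
    then show ?thesis by (simp del: of_nat_Suc of_nat_add)
  qed
  let ?a = "row Y i - i" and ?b = "col Y i - i"
  have "ln (real (hook Y i i)) \<le> ln (real (?a + 1) * real (?b + 1))"
  proof (subst ln_le_cancel_iff)
    show "real (hook Y i i) \<le> real (?a + 1) * real (?b + 1)"
      by (simp add: hook_def algebra_simps)
  qed (auto simp: hook_def)
  also have "\<dots> = ln (real (?a + 1)) + ln (real (?b + 1))" by (rule ln_mult_pos) auto
  also have "\<dots> \<le> ln_choose Y ?a + ln_choose Y ?b"
    unfolding ln_choose_def using c[of ?a] c[of ?b] by (intro add_mono) simp_all
  finally show ?thesis .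
qed

lemma ln_frobenius_degree_eq:
  assumes Y: "diagram Y" and ne: "card Y > 0"
  shows "ln (frobenius_degree Y) = ln (hook_degree Y) - ln (real (card Y)) +
    (\<Sum>i\<in>{1..durfee Y}. ln (real (hook Y i i))) +
    (\<Sum>i\<in>{1..durfee Y}. ln (row_ratio Y i)) + (\<Sum>i\<in>{1..durfee Y}. ln (row_ratio (conjugate Y) i))"
proof -
  let ?I = "{1..durfee Y}"
  let ?h = "\<Prod>i\<in>?I. real (hook Y i i)" and ?r = "\<Prod>i\<in>?I. row_ratio Y i"
  let ?s = "\<Prod>i\<in>?I. row_ratio (conjugate Y) i"
  let ?F = "\<Prod>i\<in>?I. fact (row Y i - i) * fact (col Y i - i) :: real"
  have pos: "?h > 0" "?r > 0" "?s > 0" "?F > 0"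
    by (auto intro!: prod_pos simp: hook_def row_ratio_pos)
  have ce: "fact (card Y) = real (card Y) * fact (card Y - 1)"
    using ne fact_reduce[of "card Y"] by simp
  have cancel: "x / F * n = n * x / (h * r * s * F) * (h * r * s)"
    if "0 < h" "0 < r" "0 < s" "0 < F" for x F n h r s :: real
    using that by simp
  have eq: "frobenius_degree Y * real (card Y) = hook_degree Y * (?h * ?r * ?s)"
    unfolding frobenius_degree_def hook_degree_def hook_prod_eq[OF Y] ce by (rule cancel[OF pos])
  have D: "frobenius_degree Y > 0" unfolding frobenius_degree_def using pos by simp
  have "ln (frobenius_degree Y * real (card Y)) = ln (hook_degree Y * (?h * ?r * ?s))"
    by (simp only: eq)
  then have "ln (frobenius_degree Y) + ln (real (card Y)) =
      ln (hook_degree Y) + (ln ?h + ln ?r + ln ?s)"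
    using D ne pos hook_degree_pos[of Y] by (simp add: ln_mult_pos)
  moreover have "ln ?h = (\<Sum>i\<in>?I. ln (real (hook Y i i)))"
    "ln ?r = (\<Sum>i\<in>?I. ln (row_ratio Y i))" "ln ?s = (\<Sum>i\<in>?I. ln (row_ratio (conjugate Y) i))"
    using row_ratio_pos by (auto intro!: ln_prod simp: hook_def less_imp_neq[symmetric])
  ultimately show ?thesis by simp
qed

text \<open>A coordinate is charged at most three times: in its diagonal hook, in its own row or
  column ratio, and in the cross terms of the other side. Each of the two ratio sums adds one
  square.\<close>

lemma ln_frobenius_degree_le_general:
  assumes Y: "diagram Y" and ne: "card Y > 0"
  shows "ln (frobenius_degree Y) \<le> ln (hook_degree Y) + 2 * real (durfee Y) ^ 2 +
    3 * (\<Sum>i\<in>{1..durfee Y}. ln_choose Y (row Y i - i) + ln_choose Y (col Y i - i))"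
proof -
  let ?I = "{1..durfee Y}" and ?J = "{2..durfee Y}"
  let ?a = "\<lambda>i. ln_choose Y (row Y i - i)" and ?b = "\<lambda>i. ln_choose Y (col Y i - i)"
  note Y' = diagram_conjugate[OF Y]
  have g: "ln_choose Y p \<ge> 0" for p
    unfolding ln_choose_def by (rule ln_ge_zero) (simp add: Suc_le_eq)
  have "(\<Sum>i\<in>?I. ln (real (hook Y i i))) \<le> (\<Sum>i\<in>?I. ?a i + ?b i)"
    by (rule sum_mono) (use ln_hook_diag_le[OF Y] in auto)
  moreover have "(\<Sum>i\<in>?J. ?a i) \<le> (\<Sum>i\<in>?I. ?a i)" "(\<Sum>i\<in>?J. ?b i) \<le> (\<Sum>i\<in>?I. ?b i)"
    using g by (auto intro!: sum_mono2)
  moreover have "ln (real (card Y)) \<ge> 0" using ne by simp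
  ultimately show ?thesis
    using ln_frobenius_degree_eq[OF assms] ln_row_ratio_sum_le[OF Y order_refl]
      ln_row_ratio_sum_le[OF Y' order_refl]
    by (simp add: sum.distrib)
qed

text \<open>The coordinate \<open>row Y 1 - 1\<close> escapes all three charges:
  \<open>- ln (card Y)\<close> absorbs the hook at \<open>(1, 1)\<close>,
  \<open>row_ratio_first_le\<close> handles the first row, and the cross terms start at index
  2.\<close>

lemma ln_frobenius_degree_le_first_row:
  assumes Y: "diagram Y" and ne: "card Y > 0"
  shows "ln (frobenius_degree Y) \<le> ln (hook_degree Y) + 2 * real (durfee Y) ^ 2 +
    real (card Y - row Y 1) + 3 * ((\<Sum>i\<in>{2..durfee Y}. ln_choose Y (row Y i - i)) +
    (\<Sum>i\<in>{1..durfee Y}. ln_choose Y (col Y i - i)))"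
proof -
  let ?I = "{1..durfee Y}" and ?J = "{2..durfee Y}"
  let ?a = "\<lambda>i. ln_choose Y (row Y i - i)" and ?b = "\<lambda>i. ln_choose Y (col Y i - i)"
  note Y' = diagram_conjugate[OF Y]
  have g: "ln_choose Y p \<ge> 0" for p
    unfolding ln_choose_def by (rule ln_ge_zero) (simp add: Suc_le_eq)
  have "Y \<noteq> {}" using ne by auto
  then obtain i j where "(i, j) \<in> Y" by fastforce
  then have "(1, 1) \<in> Y" using diagram_down[OF Y, of i j 1 1] diagram_pos[OF Y, of i j] by auto
  then have I: "1 \<in> ?I" using mem_diag[OF Y] by auto
  have IJ: "?I = insert 1 ?J" using I by auto
  have S: "(\<Sum>i\<in>?I. f i) = f 1 + (\<Sum>i\<in>?J. f i)" for f :: "nat \<Rightarrow> real"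
    unfolding IJ by simp
  have "(\<Sum>i\<in>?J. ln (real (hook Y i i))) \<le> (\<Sum>i\<in>?J. ?a i + ?b i)"
    by (rule sum_mono) (use ln_hook_diag_le[OF Y] in auto)
  moreover have "ln (real (hook Y 1 1)) \<le> ln (real (card Y))"
  proof -
    have "hook Y 1 1 \<le> (\<Sum>i\<in>{1}. (row Y i - i) + (col Y i - i)) + durfee Y"
      using I by (simp add: hook_def)
    also have "\<dots> \<le> card Y"
      unfolding card_diagram_split[OF Y] by (intro add_right_mono sum_mono2) (use I in auto)
    finally show ?thesis by (simp add: hook_def)
  qed
  moreover have "ln (row_ratio Y 1) \<le> real (card Y - row Y 1)"
    using row_ratio_first_le[OF Y] row_ratio_pos[of Y 1] by (metis ln_exp ln_le_cancel_iff exp_gt_zero)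
  moreover have "(\<Sum>i\<in>?J. ?b i) \<le> (\<Sum>i\<in>?I. ?b i)"
    using g by (auto intro!: sum_mono2)
  moreover have "(\<Sum>i\<in>?J. ln (row_ratio Y i)) \<le> real (durfee Y) ^ 2 + (\<Sum>i\<in>?J. ?b i) + (\<Sum>i\<in>?J. ?a i)"
    by (rule ln_row_ratio_sum_le[OF Y]) auto
  ultimately show ?thesis
    using ln_frobenius_degree_eq[OF assms] ln_row_ratio_sum_le[OF Y' order_refl]
      S[of "\<lambda>i. ln (row_ratio Y i)"] S[of "\<lambda>i. ln (real (hook Y i i))"]
    by (simp add: sum.distrib)
qed

section \<open>The linear and the logarithmic bound for the cost of a coordinate\<close>

lemma ln_choose_le_add: "ln_choose Y p \<le> real (p + durfee Y)"
proof -
  have "real ((p + durfee Y) choose durfee Y) \<le> 2 ^ (p + durfee Y)"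
    using binomial_le_pow2[of "p + durfee Y" "durfee Y"] by (metis of_nat_le_iff of_nat_numeral of_nat_power)
  then have "ln_choose Y p \<le> ln (2 ^ (p + durfee Y))"
    unfolding ln_choose_def by (subst ln_le_cancel_iff) auto
  also have "\<dots> = real (p + durfee Y) * ln 2" by (simp add: ln_realpow)
  also have "\<dots> \<le> real (p + durfee Y) * 1"
    using ln_add_one_self_le_self[of 1] by (intro mult_left_mono) auto
  finally show ?thesis by simp
qed

lemma ln_choose_le_ln: "ln_choose Y p \<le> real (durfee Y) * ln (real (p + 1))"
proof -
  let ?d = "durfee Y"
  have "real ((p + ?d) choose ?d) = (\<Prod>j\<in>{0<..0 + ?d}. 1 + real p / real (0 + ?d - j + 1))"
    by (rule prod_shifted_choose[symmetric])
  also have "\<dots> \<le> (\<Prod>j\<in>{0<..0 + ?d}. real (p + 1))"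
  proof (rule prod_mono, safe)
    fix j
    have "real p / real (0 + ?d - j + 1) \<le> real p / 1" by (rule divide_left_mono) auto
    then show "1 + real p / real (0 + ?d - j + 1) \<le> real (p + 1)" by simp
  qed simp
  also have "\<dots> = real (p + 1) ^ ?d" by simp
  finally have "ln_choose Y p \<le> ln (real (p + 1) ^ ?d)"
    unfolding ln_choose_def by (subst ln_le_cancel_iff) auto
  then show ?thesis by (simp add: ln_realpow)
qed

section \<open>Lower bounds for multinomial coefficients\<close>

lemma prod_fact_le_fact_sum:
  assumes "finite I"
  shows "(\<Prod>i\<in>I. fact (p i)) \<le> (fact (\<Sum>i\<in>I. p i) :: real)"
  using assms
proof (induction I)
  case (insert x I)
  have "(\<Prod>i\<in>insert x I. fact (p i)) \<le> fact (p x) * (fact (\<Sum>i\<in>I. p i) :: real)"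
    using insert by simp
  also have "\<dots> \<le> fact (p x + (\<Sum>i\<in>I. p i))"
    using dvd_imp_le[OF fact_fact_dvd_fact[of "p x" "\<Sum>i\<in>I. p i"]]
    by (metis fact_gt_zero of_nat_fact of_nat_le_iff of_nat_mult)
  finally show ?case using insert by simp
qed simp

text \<open>With \<open>s\<close> the sum over \<open>A\<close>, the factor lost is
  \<open>fact (N - s)\<close> over the factorials of the remaining parts, which is at least 1.
  \<open>N\<close> may exceed the sum of the parts because the Frobenius coordinates sum to
  \<open>card Y - durfee Y\<close>.\<close>

lemma multinomial_split:
  assumes I: "finite I" and A: "A \<subseteq> I" and N: "(\<Sum>i\<in>I. p i) \<le> N"
  shows "real (N choose (\<Sum>i\<in>A. p i)) * (fact (\<Sum>i\<in>A. p i) / (\<Prod>i\<in>A. fact (p i))) \<le>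
    fact N / (\<Prod>i\<in>I. fact (p i))"
proof -
  define s where "s = (\<Sum>i\<in>A. p i)"
  have fA: "finite A" using I A finite_subset by blast
  have sum: "(\<Sum>i\<in>I. p i) = s + (\<Sum>i\<in>I - A. p i)"
    unfolding s_def using sum.subset_diff[OF A I, of p] by simp
  have prod: "(\<Prod>i\<in>I. fact (p i)) = (\<Prod>i\<in>A. fact (p i)) * (\<Prod>i\<in>I - A. fact (p i) :: real)"
    using prod.subset_diff[OF A I, of "\<lambda>i. fact (p i) :: real"] by (simp add: mult.commute)
  have pos: "(\<Prod>i\<in>B. fact (p i)) > (0 :: real)" for B by (rule prod_pos) simp
  have "s \<le> N" using sum N by simp
  then have N': "(fact N :: real) = fact s * fact (N - s) * real (N choose s)"
    using binomial_fact_lemma[of s N] by (metis of_nat_fact of_nat_mult)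
  have "(\<Prod>i\<in>I - A. fact (p i)) \<le> (fact (\<Sum>i\<in>I - A. p i) :: real)"
    using I by (intro prod_fact_le_fact_sum) auto
  also have "\<dots> \<le> fact (N - s)" using sum N by (intro fact_mono) simp
  finally have le: "(\<Prod>i\<in>I - A. fact (p i)) \<le> (fact (N - s) :: real)" .
  have "real (N choose s) * (fact s / (\<Prod>i\<in>A. fact (p i))) =
      real (N choose s) * fact s / (\<Prod>i\<in>A. fact (p i)) * 1" by simp
  also have "\<dots> \<le> real (N choose s) * fact s / (\<Prod>i\<in>A. fact (p i)) *
      (fact (N - s) / (\<Prod>i\<in>I - A. fact (p i)))"
    using le pos[of "I - A"] pos[of A] by (intro mult_left_mono) simp_all
  also have "\<dots> = fact N / (\<Prod>i\<in>I. fact (p i))" unfolding prod N' by simp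
  finally show ?thesis unfolding s_def .
qed

lemma ln_multinomial_ge_binomial:
  assumes I: "finite I" and A: "A \<subseteq> I" and N: "(\<Sum>i\<in>I. p i) \<le> N"
  shows "ln (real (N choose (\<Sum>i\<in>A. p i))) \<le> ln (fact N / (\<Prod>i\<in>I. fact (p i)))"
proof -
  define s where "s = (\<Sum>i\<in>A. p i)"
  have fA: "finite A" using I A finite_subset by blast
  have pos: "(\<Prod>i\<in>A. fact (p i)) > (0 :: real)" by (rule prod_pos) simp
  have "s \<le> N" unfolding s_def using sum_mono2[OF I A, of p] N by simp
  then have c: "real (N choose s) > 0" by simp
  have "real (N choose s) * 1 \<le> real (N choose s) * (fact s / (\<Prod>i\<in>A. fact (p i)))"
    using prod_fact_le_fact_sum[OF fA, of p] pos c unfolding s_def by (intro mult_left_mono) simp_all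
  also have "\<dots> \<le> fact N / (\<Prod>i\<in>I. fact (p i))"
    unfolding s_def by (rule multinomial_split[OF assms])
  finally have "real (N choose s) \<le> fact N / (\<Prod>i\<in>I. fact (p i))" by simp
  then show ?thesis
    unfolding s_def[symmetric] using c by (subst ln_le_cancel_iff) linarith+
qed

lemma ln_binomial_ge:
  assumes "0 < s" "s \<le> N"
  shows "real s * ln (real N / real s) \<le> ln (real (N choose s))"
proof -
  have "(real N / real s) ^ s \<le> real (N choose s)"
    using binomial_ge_n_over_k_pow_k[of s N, where 'a = real] assms by simp
  moreover have "0 < real N / real s" using assms by simp
  ultimately have "ln ((real N / real s) ^ s) \<le> ln (real (N choose s))"
    by (subst ln_le_cancel_iff) (auto intro: zero_less_power simp: assms)
  then show ?thesis using \<open>0 < real N / real s\<close> by (simp add: ln_realpow)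
qed

text \<open>As \<open>fact (p i)\<close> is at most \<open>t ^ p i\<close> and \<open>fact s\<close>
  at least \<open>(s / e) ^ s\<close>, the multinomial coefficient of the parts in \<open>A\<close>
  is at least \<open>(s / (e * t)) ^ s\<close>.\<close>

lemma ln_multinomial_ge_small_parts:
  assumes I: "finite I" and A: "A \<subseteq> I" and N: "(\<Sum>i\<in>I. p i) \<le> N"
    and t: "\<And>i. i \<in> A \<Longrightarrow> real (p i) \<le> t" "0 < t" and s: "0 < (\<Sum>i\<in>A. p i)"
  shows "real (\<Sum>i\<in>A. p i) * (ln (real (\<Sum>i\<in>A. p i)) - 1 - ln t) \<le>
    ln (fact N / (\<Prod>i\<in>I. fact (p i)))"
proof -
  define s where "s = (\<Sum>i\<in>A. p i)"
  have s0: "0 < s" using assms by (simp add: s_def)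
  have fA: "finite A" using I A finite_subset by blast
  have pos: "(\<Prod>i\<in>A. fact (p i)) > (0 :: real)" by (rule prod_pos) simp
  have "s \<le> N" unfolding s_def using sum_mono2[OF I A, of p] N by simp
  have 1: "(\<Prod>i\<in>A. fact (p i)) \<le> t ^ s"
  proof -
    have "(\<Prod>i\<in>A. fact (p i)) \<le> (\<Prod>i\<in>A. t ^ p i)"
    proof (rule prod_mono, safe)
      fix i assume i: "i \<in> A"
      have "fact (p i) \<le> real (p i) ^ p i" using fact_le_power[of "p i", where 'a = real] by simp
      also have "\<dots> \<le> t ^ p i" using t(1)[OF i] by (intro power_mono) auto
      finally show "fact (p i) \<le> t ^ p i" .
    qed simp
    then show ?thesis by (simp add: s_def power_sum)
  qed
  have 2: "real s ^ s \<le> exp (real s) * fact s"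
    using power_div_fact_le_exp[of "real s" s] by (simp add: divide_simps)
  have "(real s / (exp 1 * t)) ^ s = real s ^ s / exp (real s) / t ^ s"
    by (simp add: power_divide power_mult_distrib exp_of_nat_mult[symmetric])
  also have "\<dots> \<le> fact s / t ^ s"
    using 2 t(2) by (intro divide_right_mono) (auto simp: divide_simps mult.commute)
  also have "\<dots> \<le> fact s / (\<Prod>i\<in>A. fact (p i))"
    using 1 pos t(2) by (intro divide_left_mono) auto
  also have "\<dots> \<le> real (N choose s) * (fact s / (\<Prod>i\<in>A. fact (p i)))"
  proof -
    have "1 \<le> real (N choose s)" using \<open>s \<le> N\<close> by (simp add: Suc_le_eq)
    then show ?thesis
      using mult_right_mono[of 1 "real (N choose s)" "fact s / (\<Prod>i\<in>A. fact (p i))"] pos by simp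
  qed
  also have "\<dots> \<le> fact N / (\<Prod>i\<in>I. fact (p i))"
    unfolding s_def by (rule multinomial_split[OF I A N])
  finally have "(real s / (exp 1 * t)) ^ s \<le> fact N / (\<Prod>i\<in>I. fact (p i))" .
  moreover have x: "0 < real s / (exp 1 * t)" using s0 t(2) by simp
  ultimately have "ln ((real s / (exp 1 * t)) ^ s) \<le> ln (fact N / (\<Prod>i\<in>I. fact (p i)))"
    by (subst ln_le_cancel_iff) (auto intro: zero_less_power order.strict_trans2)
  moreover have "ln ((real s / (exp 1 * t)) ^ s) = real s * (ln (real s) - 1 - ln t)"
    using x s0 t(2) by (simp add: ln_realpow ln_div ln_mult_pos)
  ultimately show ?thesis by (simp add: s_def)
qed

text \<open>
  If the sum \<open>s\<close> of the small parts is at most \<open>n powr 0.8\<close>, the binomial coefficient \<open>N choose s\<close>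
  alone is large enough. Otherwise the multinomial coefficient of the small parts is.
\<close>

lemma ln_multinomial_ge_below_threshold:
  assumes I: "finite I" and A: "A \<subseteq> I" and N: "(\<Sum>i\<in>I. p i) \<le> N" "n = N + 1"
    and t: "\<And>i. i \<in> A \<Longrightarrow> real (p i) \<le> real n powr 0.6" and n: "10 \<le> ln (real n)"
  shows "0.1 * ln (real n) * real (\<Sum>i\<in>A. p i) \<le> ln (fact N / (\<Prod>i\<in>I. fact (p i)))"
proof -
  define s where "s = (\<Sum>i\<in>A. p i)"
  define L where "L = ln (real n)"
  have n0: "real n > 0" using N(2) by simp
  have N1: "N \<ge> 1" using n N(2) by (cases N) auto
  have sN: "s \<le> N" unfolding s_def using sum_mono2[OF I A, of p] N by simp
  consider "s = 0" | "0 < s" "real s \<le> real n powr 0.8" | "0 < s" "real n powr 0.8 < real s"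
    by linarith
  then show ?thesis
  proof cases
    case 1
    have "0 \<le> ln (real (N choose s))" using 1 by simp
    also have "\<dots> \<le> ln (fact N / (\<Prod>i\<in>I. fact (p i)))"
      unfolding s_def by (rule ln_multinomial_ge_binomial[OF I A N(1)])
    finally show ?thesis using 1 by (simp add: s_def)
  next
    case 2
    have "ln (real n / 2) \<le> ln (real N)" using N1 N(2) by (subst ln_le_cancel_iff) auto
    then have "L - ln 2 \<le> ln (real N)" using n0 by (simp add: ln_div L_def)
    moreover have "ln (real s) \<le> ln (real n powr 0.8)" using 2 n0 by (subst ln_le_cancel_iff) auto
    then have "ln (real s) \<le> 0.8 * L" using n0 by (simp add: ln_powr L_def)
    moreover have "ln 2 \<le> (1 :: real)" using ln_add_one_self_le_self[of 1] by simp
    \<comment> \<open>The exponents 1 and 0.8 leave \<open>0.2 * L\<close>, of which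
      \<open>ln 2\<close> costs at most \<open>0.1 * L\<close> because \<open>L\<close> is at least
      10. In the third case the exponents 0.8 and 0.6 leave the same margin, and the loss is the
      summand 1.\<close>
    ultimately have "0.1 * L \<le> ln (real N) - ln (real s)" using n L_def by simp
    also have "\<dots> = ln (real N / real s)" using 2 N1 by (simp add: ln_div)
    finally have "real s * (0.1 * L) \<le> real s * ln (real N / real s)" by (intro mult_left_mono) auto
    also have "\<dots> \<le> ln (real (N choose s))" by (rule ln_binomial_ge) (use 2 sN in auto)
    also have "\<dots> \<le> ln (fact N / (\<Prod>i\<in>I. fact (p i)))"
      unfolding s_def by (rule ln_multinomial_ge_binomial[OF I A N(1)])
    finally show ?thesis by (simp add: s_def L_def mult.commute mult.left_commute)
  next
    case 3
    have "ln (real n powr 0.8) \<le> ln (real s)" using 3 n0 by (subst ln_le_cancel_iff) auto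
    then have "0.8 * L \<le> ln (real s)" using n0 by (simp add: ln_powr L_def)
    moreover have "ln (real n powr 0.6) = 0.6 * L" using n0 by (simp add: ln_powr L_def)
    ultimately have "0.1 * L \<le> ln (real s) - 1 - ln (real n powr 0.6)" using n L_def by simp
    then have "real s * (0.1 * L) \<le> real s * (ln (real s) - 1 - ln (real n powr 0.6))"
      by (intro mult_left_mono) auto
    also have "\<dots> \<le> ln (fact N / (\<Prod>i\<in>I. fact (p i)))"
      unfolding s_def by (rule ln_multinomial_ge_small_parts[OF I A N(1) t])
        (use 3 n0 in \<open>auto simp: s_def\<close>)
    finally show ?thesis by (simp add: s_def L_def mult.commute mult.left_commute)
  qed
qed

text \<open>For the first row, with \<open>N = card Y - 1\<close> and
  \<open>p x = row Y 1 - 1\<close>, the complementary index \<open>k\<close> is the number of cells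
  outside that row.\<close>

lemma ln_multinomial_ge_codegree:
  assumes I: "finite I" and N: "(\<Sum>i\<in>I. p i) \<le> N" and x: "x \<in> I"
    and k: "k = N - p x" "0 < k"
  shows "real k * ln (real N / real k) \<le> ln (fact N / (\<Prod>i\<in>I. fact (p i)))"
proof -
  have "p x \<le> (\<Sum>i\<in>I. p i)" using I x by (simp add: member_le_sum)
  then have "N choose (p x) = N choose k"
    using binomial_symmetric[of "p x" N] N k by simp
  moreover have "real k * ln (real N / real k) \<le> ln (real (N choose k))"
    by (rule ln_binomial_ge) (use k in auto)
  ultimately show ?thesis
    using ln_multinomial_ge_binomial[OF I _ N, of "{x}"] x by simp
qed

lemma ln_2_ge_half: "1 / 2 \<le> ln (2 :: real)"
  using ln_le_minus_one[of "1 / 2 :: real"] by (simp add: ln_div)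

section \<open>The degree estimate for diagrams\<close>

text \<open>The flag selects arm or leg, which puts all coordinates into one family and makes the
  virtual degree a single multinomial-type quotient.\<close>

definition frob_index :: "(nat \<times> nat) set \<Rightarrow> (nat \<times> bool) set" where
  "frob_index Y = {1..durfee Y} \<times> UNIV"

definition frob_part :: "(nat \<times> nat) set \<Rightarrow> nat \<times> bool \<Rightarrow> nat" where
  "frob_part Y = (\<lambda>(i, t). if t then row Y i - i else col Y i - i)"

lemma finite_frob_index: "finite (frob_index Y)"
  by (simp add: frob_index_def)

lemma sum_frob_index:
  "(\<Sum>x\<in>frob_index Y. f (frob_part Y x)) = (\<Sum>i\<in>{1..durfee Y}. f (row Y i - i) + f (col Y i - i))"
  for f :: "nat \<Rightarrow> 'b::comm_monoid_add"
proof -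
  have "(\<Sum>x\<in>frob_index Y. f (frob_part Y x)) =
      (\<Sum>i\<in>{1..durfee Y}. \<Sum>t\<in>UNIV. f (frob_part Y (i, t)))"
    unfolding frob_index_def by (simp add: sum.cartesian_product)
  then show ?thesis by (simp add: UNIV_bool frob_part_def add.commute)
qed

lemma frobenius_degree_eq_multinomial:
  "frobenius_degree Y = fact (card Y - 1) / (\<Prod>x\<in>frob_index Y. fact (frob_part Y x))"
proof -
  have "(\<Prod>x\<in>frob_index Y. fact (frob_part Y x) :: real) =
      (\<Prod>i\<in>{1..durfee Y}. \<Prod>t\<in>UNIV. fact (frob_part Y (i, t)))"
    unfolding frob_index_def by (simp add: prod.cartesian_product)
  also have "\<dots> = (\<Prod>i\<in>{1..durfee Y}. fact (row Y i - i) * fact (col Y i - i))"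
    by (simp add: UNIV_bool frob_part_def mult.commute)
  finally show ?thesis by (simp add: frobenius_degree_def)
qed

lemma sum_frob_part:
  assumes "diagram Y"
  shows "(\<Sum>x\<in>frob_index Y. frob_part Y x) + durfee Y = card Y"
  using card_diagram_split[OF assms] sum_frob_index[of "\<lambda>x. x" Y] by simp

text \<open>The Durfee square alone forces this much. Summed over all indices it yields
  \<open>durfee Y * (durfee Y - 1)\<close>, which is how \<open>durfee Y ^ 2\<close> is charged to
  the coordinates.\<close>

lemma frob_part_ge:
  assumes Y: "diagram Y" and x: "x \<in> frob_index Y"
  shows "real (durfee Y) - real (fst x) \<le> real (frob_part Y x)"
  using durfee_le_row[OF Y, of "fst x"] durfee_le_col[OF Y, of "fst x"] x
  by (auto simp: frob_index_def frob_part_def split: prod.splits)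

lemma sum_staircase: "(\<Sum>i\<in>{1..d}. real d - real i) = real d * (real d - 1) / 2"
proof -
  have "2 * (\<Sum>i\<in>{1..d}. real i) = real d * (real d + 1)"
    using double_gauss_sum_from_Suc_0[of d, where 'a = real] by simp
  then show ?thesis by (simp add: sum_subtractf algebra_simps power2_eq_square)
qed

lemma sum_frob_staircase:
  "(\<Sum>x\<in>frob_index Y. real (durfee Y) - real (fst x)) = real (durfee Y) * (real (durfee Y) - 1)"
proof -
  have "(\<Sum>x\<in>frob_index Y. real (durfee Y) - real (fst x)) =
      (\<Sum>i\<in>{1..durfee Y}. \<Sum>t\<in>(UNIV :: bool set). real (durfee Y) - real i)"
    unfolding frob_index_def sum.cartesian_product case_prod_unfold ..
  also have "\<dots> = (\<Sum>i\<in>{1..durfee Y}. 2 * (real (durfee Y) - real i))" by simp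
  also have "\<dots> = 2 * (\<Sum>i\<in>{1..durfee Y}. real (durfee Y) - real i)"
    by (rule sum_distrib_left[symmetric])
  finally show ?thesis unfolding sum_staircase by simp
qed

lemma durfee_square_le:
  assumes Y: "diagram Y"
  shows "real (durfee Y) ^ 2 \<le> real (card Y)"
proof -
  have "real (durfee Y) * (real (durfee Y) - 1) \<le> (\<Sum>x\<in>frob_index Y. real (frob_part Y x))"
    unfolding sum_frob_staircase[symmetric] by (rule sum_mono) (rule frob_part_ge[OF Y])
  also have "\<dots> = real (card Y) - real (durfee Y)"
    using sum_frob_part[OF Y] by (simp flip: of_nat_sum)
  finally show ?thesis by (simp add: algebra_simps power2_eq_square)
qed

lemma durfee_pos:
  assumes Y: "diagram Y" and ne: "card Y > 0"
  shows "1 \<le> durfee Y"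
proof -
  have "Y \<noteq> {}" using ne by auto
  then obtain i j where "(i, j) \<in> Y" by fastforce
  then have "(1, 1) \<in> Y" using diagram_down[OF Y, of i j 1 1] diagram_pos[OF Y, of i j] by auto
  then show ?thesis using mem_diag[OF Y, of 1] by simp
qed

text \<open>The difference of logarithms is at most \<open>28 * k\<close>, while
  \<open>ln (frobenius_degree Y)\<close> is at least \<open>0.02 * k * ln n\<close>; the constant is
  1400 = 28 / 0.02.\<close>

lemma ln_degree_diff_le_small_codegree:
  assumes Y: "diagram Y" and k: "k = card Y - row Y 1" "0 < k"
    and L: "100 \<le> ln (real (card Y))" and small: "real k \<le> real (card Y) powr 0.95"
  shows "(ln (frobenius_degree Y) - ln (hook_degree Y)) * ln (real (card Y)) \<le>
    1400 * ln (frobenius_degree Y)"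
proof -
  define n where "n = card Y"
  define d where "d = durfee Y"
  have n0: "n > 0" using k by (simp add: n_def)
  have n2: "n \<ge> 2" using L by (cases "n = 1") (use n0 in \<open>auto simp: n_def\<close>)
  have d1: "1 \<le> d" using durfee_pos[OF Y] n0 by (simp add: n_def d_def)
  have row1: "1 \<le> row Y 1" using durfee_le_row[OF Y, of 1] d1 by (simp add: d_def)
  have S: "(\<Sum>i\<in>{1..d}. f i) = f 1 + (\<Sum>i\<in>{2..d}. f i)" for f :: "nat \<Rightarrow> real"
  proof -
    have "{1..d} = insert 1 {2..d}" using d1 by auto
    then show ?thesis by simp
  qed
  define A where "A = (\<Sum>i\<in>{2..d}. real (row Y i - i))"
  define B where "B = (\<Sum>i\<in>{1..d}. real (col Y i - i))"
  have "real (\<Sum>i\<in>{1..d}. (row Y i - i) + (col Y i - i)) + real d = real n"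
    using arg_cong[OF card_diagram_split[OF Y], of real] unfolding n_def d_def by (simp only: of_nat_add)
  then have "real (row Y 1 - 1) + A + B + real d = real n"
    using S[of "\<lambda>i. real (row Y i - i)"] by (simp add: sum.distrib A_def B_def)
  then have AB: "A + B + real d = real k + 1"
    using row1 k by (simp add: n_def of_nat_diff)
  \<comment> \<open>The legs alone contain a staircase, and \<open>AB\<close> bounds their sum in
    terms of \<open>k\<close>; this makes \<open>d ^ 2\<close> of order \<open>k\<close>.\<close>
  have "real d * (real d - 1) / 2 \<le> B"
    unfolding B_def sum_staircase[symmetric]
    by (rule sum_mono) (use durfee_le_col[OF Y] in \<open>fastforce simp: d_def of_nat_diff\<close>)
  moreover have "0 \<le> A" unfolding A_def by (rule sum_nonneg) simp
  ultimately have "real d * (real d - 1) / 2 + real d \<le> real k + 1" using AB by simp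
  then have "real d ^ 2 + real d \<le> 2 * real k + 2" by (simp add: field_simps power2_eq_square)
  then have dk: "real d ^ 2 \<le> 3 * real k" using d1 k by simp
  have "(\<Sum>i\<in>{2..d}. ln_choose Y (row Y i - i)) \<le> (\<Sum>i\<in>{2..d}. real (row Y i - i) + real d)"
    by (rule sum_mono) (use ln_choose_le_add[of Y] in \<open>simp add: d_def\<close>)
  also have "\<dots> \<le> A + real d * real d"
    by (simp add: sum.distrib A_def mult_right_mono)
  finally have 1: "(\<Sum>i\<in>{2..d}. ln_choose Y (row Y i - i)) \<le> A + real d ^ 2"
    by (simp add: power2_eq_square)
  have "(\<Sum>i\<in>{1..d}. ln_choose Y (col Y i - i)) \<le> (\<Sum>i\<in>{1..d}. real (col Y i - i) + real d)"
    by (rule sum_mono) (use ln_choose_le_add[of Y] in \<open>simp add: d_def\<close>)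
  also have "\<dots> = B + real d ^ 2"
    by (simp add: sum.distrib B_def power2_eq_square)
  finally have 2: "(\<Sum>i\<in>{1..d}. ln_choose Y (col Y i - i)) \<le> B + real d ^ 2" .
  have "ln (frobenius_degree Y) - ln (hook_degree Y) \<le> 2 * real d ^ 2 + real k + 3 * (A + B + 2 * real d ^ 2)"
    using ln_frobenius_degree_le_first_row[OF Y] n0 1 2 k by (simp add: n_def d_def)
  \<comment> \<open>\<open>d ^ 2\<close> is at most \<open>3 * k\<close> and \<open>A + B\<close> at
    most \<open>k\<close>, so the total is 6 + 1 + 3 * (1 + 6) times \<open>k\<close>.\<close>
  also have "\<dots> \<le> 28 * real k" using AB dk d1 by simp
  finally have up: "ln (frobenius_degree Y) - ln (hook_degree Y) \<le> 28 * real k" .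
  have x: "(1, True) \<in> frob_index Y" using d1 by (simp add: frob_index_def d_def)
  have "real k * ln (real (n - 1) / real k) \<le> ln (frobenius_degree Y)"
    unfolding frobenius_degree_eq_multinomial n_def
    by (rule ln_multinomial_ge_codegree[OF finite_frob_index _ x])
      (use sum_frob_part[OF Y] d1 k row1 in \<open>auto simp: frob_part_def d_def\<close>)
  moreover have "real k * (0.02 * ln (real n)) \<le> real k * ln (real (n - 1) / real k)"
  proof (rule mult_left_mono)
    have "ln (real n / 2) \<le> ln (real (n - 1))" using n2 by (subst ln_le_cancel_iff) (auto simp: of_nat_diff)
    then have "ln (real n) - ln 2 \<le> ln (real (n - 1))" using n0 by (simp add: ln_div)
    moreover have "ln (real k) \<le> ln (real n powr 0.95)"
      using small k n0 by (subst ln_le_cancel_iff) (auto simp: n_def)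
    then have "ln (real k) \<le> 0.95 * ln (real n)" using n0 by (simp add: ln_powr)
    moreover have "ln 2 \<le> (1 :: real)" using ln_add_one_self_le_self[of 1] by simp
    \<comment> \<open>The exponent 0.95 leaves \<open>0.05 * ln n\<close>, and \<open>ln 2\<close>
      costs at most \<open>0.01 * ln n\<close>.\<close>
    ultimately have "0.02 * ln (real n) \<le> ln (real (n - 1)) - ln (real k)"
      using L by (simp add: n_def)
    also have "\<dots> = ln (real (n - 1) / real k)" using n2 k by (simp add: ln_div)
    finally show "0.02 * ln (real n) \<le> ln (real (n - 1) / real k)" .
  qed simp
  ultimately have low: "real k * (0.02 * ln (real n)) \<le> ln (frobenius_degree Y)" by simp
  have "(ln (frobenius_degree Y) - ln (hook_degree Y)) * ln (real n) \<le> 28 * real k * ln (real n)"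
    using up L by (intro mult_right_mono) (auto simp: n_def)
  also have "\<dots> = 1400 * (real k * (0.02 * ln (real n)))" by simp
  also have "\<dots> \<le> 1400 * ln (frobenius_degree Y)" using low by simp
  finally show ?thesis by (simp add: n_def)
qed

text \<open>By \<open>rc\<close> the first row carries the largest coordinate \<open>M\<close>. If
  \<open>M\<close> is at most \<open>n / 8\<close>, all parts are small against their sum; in the
  middle range \<open>(n - 1) choose M\<close> is exponential in \<open>n\<close>; above half of
  \<open>n - 1\<close> the complementary index \<open>k\<close> takes over, which is large by
  hypothesis.\<close>

lemma ln_frobenius_degree_ge_power:
  assumes Y: "diagram Y" and k: "k = card Y - row Y 1"
    and rc: "col Y 1 \<le> row Y 1"
    and L: "100 \<le> ln (real (card Y))" and large: "real (card Y) powr 0.95 < real k"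
  shows "real (card Y) powr 0.95 / 32 \<le> ln (frobenius_degree Y)"
proof -
  define n where "n = card Y"
  define d where "d = durfee Y"
  define M where "M = row Y 1 - 1"
  have n0: "n > 0" using L by (cases "n = 0") (auto simp: n_def)
  have n100: "n \<ge> 100"
  proof -
    have "ln (real n) \<le> real n" using n0 ln_le_minus_one[of "real n"] by simp
    then show ?thesis using L by (simp add: n_def)
  qed
  have d1: "1 \<le> d" using durfee_pos[OF Y] n0 by (simp add: n_def d_def)
  have row1: "1 \<le> row Y 1" using durfee_le_row[OF Y, of 1] d1 by (simp add: d_def)
  have k0: "0 < k" using large by (cases k) auto
  have kM: "k = (n - 1) - M" using k row1 by (simp add: n_def M_def)
  have x: "(1, True) \<in> frob_index Y" using d1 by (simp add: frob_index_def d_def)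
  have px: "frob_part Y (1, True) = M" by (simp add: frob_part_def M_def)
  have sum: "(\<Sum>x\<in>frob_index Y. frob_part Y x) \<le> n - 1"
    using sum_frob_part[OF Y] d1 by (simp add: n_def d_def)
  have n95: "real n powr 0.95 \<le> real n"
    using powr_mono[of "0.95" 1 "real n"] n0 by simp
  have "real n powr 0.95 / 32 \<le> ln (frobenius_degree Y)"
  proof (cases "8 * M \<le> n")
    case True
    define s where "s = (\<Sum>x\<in>frob_index Y. frob_part Y x)"
    have "5 * real d \<le> real n"
    proof -
      have "real d * real d \<le> real n" using durfee_square_le[OF Y] by (simp add: d_def n_def power2_eq_square)
      \<comment> \<open>Expanding the square bounds \<open>20 * d\<close> by
        \<open>d ^ 2 + 100\<close>, hence by \<open>n + 100\<close> and by
        \<open>2 * n\<close>.\<close>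
      moreover have "0 \<le> (real d - 10) * (real d - 10)" by simp
      ultimately show ?thesis using n100 by (simp add: algebra_simps)
    qed
    then have sn: "real n / 2 \<le> real s"
      using arg_cong[OF sum_frob_part[OF Y], of real]
      unfolding s_def d_def n_def of_nat_add by simp
    have s0: "0 < s" using sn n0 by (cases "s = 0") auto
    have part: "real (frob_part Y y) \<le> real n / 8" if "y \<in> frob_index Y" for y
    proof -
      obtain i t where y: "y = (i, t)" by fastforce
      have i: "1 \<le> i" using that y by (auto simp: frob_index_def)
      have "frob_part Y y \<le> M"
        using row_antimono[OF Y, of 1 i] col_antimono[OF Y, of 1 i] i rc
        by (auto simp: y frob_part_def M_def)
      then show ?thesis using True by simp
    qed
    have "real s * (ln (real s) - 1 - ln (real n / 8)) \<le> ln (frobenius_degree Y)"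
      unfolding frobenius_degree_eq_multinomial s_def n_def[symmetric]
      by (rule ln_multinomial_ge_small_parts[OF finite_frob_index order_refl sum part])
        (use n0 s0 in \<open>auto simp: s_def\<close>)
    moreover have "1 / 4 \<le> ln (real s) - 1 - ln (real n / 8)"
    proof -
      have "ln (real n / 2) \<le> ln (real s)" using sn s0 n0 by (subst ln_le_cancel_iff) auto
      moreover have "ln (real n / 2) - ln (real n / 8) = ln 4" using ln_mult_pos[of "real n / 8" 4] n0 by simp
      \<comment> \<open>\<open>ln 4\<close> has to exceed the 1 subtracted in
        \<open>ln_multinomial_ge_small_parts\<close>; writing it as \<open>ln 3 - ln (3 / 4)\<close>
        gives at least 1 + 1 / 4.\<close>
      moreover have "(5 / 4 :: real) \<le> ln 4"
      proof -
        have "ln (3 / 4) \<le> (3 / 4 :: real) - 1" by (rule ln_le_minus_one) simp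
        moreover have "(1 :: real) \<le> ln 3" using exp_le by (metis exp_gt_zero ln_exp ln_le_cancel_iff zero_less_numeral)
        moreover have "ln (3 / 4 :: real) = ln 3 - ln 4" by (simp add: ln_div)
        ultimately show ?thesis by simp
      qed
      ultimately show ?thesis by simp
    qed
    then have "real s * (1 / 4) \<le> real s * (ln (real s) - 1 - ln (real n / 8))"
      by (intro mult_left_mono) auto
    ultimately show ?thesis using sn n95 by simp
  next
    case M: False
    show ?thesis
    proof (cases "2 * M \<le> n - 1")
      case True
      have M0: "0 < M" using M by simp
      have "1 / 2 \<le> ln (real (n - 1) / real M)"
      proof -
        have "2 \<le> real (n - 1) / real M" using True M0 by (simp add: field_simps flip: of_nat_mult)
        then have "ln 2 \<le> ln (real (n - 1) / real M)" by (subst ln_le_cancel_iff) linarith+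
        then show ?thesis using ln_2_ge_half by simp
      qed
      then have "real M * (1 / 2) \<le> real M * ln (real (n - 1) / real M)"
        by (intro mult_left_mono) auto
      also have "\<dots> \<le> ln (real ((n - 1) choose M))"
        by (rule ln_binomial_ge) (use M0 True in auto)
      also have "\<dots> \<le> ln (frobenius_degree Y)"
        unfolding frobenius_degree_eq_multinomial n_def[symmetric]
        using ln_multinomial_ge_binomial[OF finite_frob_index _ sum, of "{(1, True)}"] x px by simp
      finally show ?thesis using M n95 by simp
    next
      case False
      have "real k * (1 / 2) \<le> real k * ln (real (n - 1) / real k)"
      proof (rule mult_left_mono)
        have "2 * k \<le> n - 1" using False kM by simp
        then have "2 \<le> real (n - 1) / real k" using k0 by (simp add: field_simps flip: of_nat_mult)
        then have "ln 2 \<le> ln (real (n - 1) / real k)" by (subst ln_le_cancel_iff) linarith+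
        then show "1 / 2 \<le> ln (real (n - 1) / real k)" using ln_2_ge_half by simp
      qed simp
      also have "\<dots> \<le> ln (frobenius_degree Y)"
        unfolding frobenius_degree_eq_multinomial n_def[symmetric]
        by (rule ln_multinomial_ge_codegree[OF finite_frob_index sum x]) (use kM k0 px in auto)
      finally have "real k * (1 / 2) \<le> ln (frobenius_degree Y)" .
      moreover have "real n powr 0.95 < real k" using large by (simp add: n_def)
      moreover have "0 \<le> real n powr 0.95" by simp
      ultimately show ?thesis by linarith
    qed
  qed
  then show ?thesis by (simp add: n_def)
qed

text \<open>The two bounds for \<open>ln_choose\<close> are split at \<open>n powr 0.6\<close>:
  smaller coordinates are charged linearly, larger ones \<open>d * ln n\<close> each.\<close>

lemma ln_degree_diff_le_large_codegree:
  assumes Y: "diagram Y" and k: "k = card Y - row Y 1"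
    and rc: "col Y 1 \<le> row Y 1"
    and L: "100 \<le> ln (real (card Y))" and large: "real (card Y) powr 0.95 < real k"
    and growth: "real (card Y) powr 0.9 * ln (real (card Y)) ^ 2 \<le> real (card Y) powr 0.95"
  shows "(ln (frobenius_degree Y) - ln (hook_degree Y)) * ln (real (card Y)) \<le>
    1400 * ln (frobenius_degree Y)"
proof -
  define n where "n = card Y"
  define d where "d = durfee Y"
  define I where "I = frob_index Y"
  define p where "p = frob_part Y"
  define lg where "lg = ln (real n)"
  define A where "A = {x \<in> I. real (p x) \<le> real n powr 0.6}"
  define s where "s = (\<Sum>x\<in>A. p x)"
  have n0: "n > 0" using L by (cases "n = 0") (auto simp: n_def)
  have n1: "1 \<le> real n" using n0 by simp
  have lg: "100 \<le> lg" using L by (simp add: lg_def n_def)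
  have d1: "1 \<le> d" using durfee_pos[OF Y] n0 by (simp add: n_def d_def)
  have fin: "finite I" "finite A" "A \<subseteq> I" by (auto simp: I_def A_def finite_frob_index)
  have sum: "(\<Sum>x\<in>I. p x) \<le> n - 1"
    using sum_frob_part[OF Y] d1 by (simp add: n_def d_def I_def p_def)
  have D: "frobenius_degree Y = fact (n - 1) / (\<Prod>x\<in>I. fact (p x))"
    unfolding frobenius_degree_eq_multinomial n_def I_def p_def ..
  have cardI: "real (card I) = 2 * real d"
    by (simp add: I_def frob_index_def d_def card_cartesian_product)
  have cardLarge: "real (card (I - A)) \<le> real n powr 0.4"
  proof -
    have "real (card (I - A)) * real n powr 0.6 = (\<Sum>x\<in>I - A. real n powr 0.6)" by simp
    also have "\<dots> \<le> (\<Sum>x\<in>I - A. real (p x))" by (rule sum_mono) (auto simp: A_def)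
    also have "\<dots> \<le> (\<Sum>x\<in>I. real (p x))" using fin by (intro sum_mono2) auto
    also have "\<dots> \<le> real n" using sum by (simp flip: of_nat_sum)
    also have "\<dots> = real n powr 0.4 * real n powr 0.6" using n0 by (simp flip: powr_add)
    finally show ?thesis using n0 by simp
  qed
  have d5: "real d \<le> real n powr 0.5"
  proof -
    have "real d ^ 2 \<le> (real n powr 0.5) ^ 2"
      using durfee_square_le[OF Y] n0 by (simp add: d_def n_def powr_half_sqrt)
    then show ?thesis by (rule power2_le_imp_le) simp
  qed
  have ld: "real (card (I - A)) * real d \<le> real n powr 0.9"
  proof -
    have "real (card (I - A)) * real d \<le> real n powr 0.4 * real n powr 0.5"
      using cardLarge d5 by (intro mult_mono) auto
    also have "\<dots> = real n powr 0.9" by (simp flip: powr_add)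
    finally show ?thesis .
  qed
  have d9: "real d \<le> real n powr 0.9"
    using d5 powr_mono[of "0.5" "0.9" "real n"] n1 by simp
  \<comment> \<open>In the staircase sum a small index contributes at most its own coordinate and a
    large one at most \<open>d\<close>, so the square is charged to \<open>s\<close> up to terms of
    exponent 0.9.\<close>
  have dsq: "real d ^ 2 \<le> real s + 2 * real n powr 0.9"
  proof -
    have "real d * (real d - 1) = (\<Sum>x\<in>I. real d - real (fst x))"
      unfolding I_def d_def by (rule sum_frob_staircase[symmetric])
    also have "\<dots> = (\<Sum>x\<in>A. real d - real (fst x)) + (\<Sum>x\<in>I - A. real d - real (fst x))"
      using sum.subset_diff[OF fin(3,1)] by (simp add: add.commute)
    also have "\<dots> \<le> (\<Sum>x\<in>A. real (p x)) + (\<Sum>x\<in>I - A. real d)"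
      by (intro add_mono sum_mono) (use frob_part_ge[OF Y] fin in \<open>auto simp: p_def I_def d_def\<close>)
    also have "\<dots> \<le> real s + real n powr 0.9" using ld by (simp add: s_def)
    finally show ?thesis using d9 by (simp add: algebra_simps power2_eq_square)
  qed
  have small: "(\<Sum>x\<in>A. ln_choose Y (p x)) \<le> real s + 2 * real d ^ 2"
  proof -
    have "(\<Sum>x\<in>A. ln_choose Y (p x)) \<le> (\<Sum>x\<in>A. real (p x) + real d)"
      by (rule sum_mono) (use ln_choose_le_add[of Y] in \<open>simp add: d_def\<close>)
    also have "\<dots> = real s + real (card A) * real d" by (simp add: sum.distrib s_def)
    also have "real (card A) * real d \<le> 2 * real d * real d"
      unfolding cardI[symmetric] using fin by (intro mult_right_mono) (auto intro: card_mono)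
    finally show ?thesis by (simp add: power2_eq_square)
  qed
  have big: "(\<Sum>x\<in>I - A. ln_choose Y (p x)) \<le> real n powr 0.9 * lg"
  proof -
    have "(\<Sum>x\<in>I - A. ln_choose Y (p x)) \<le> (\<Sum>x\<in>I - A. real d * lg)"
    proof (rule sum_mono)
      fix x assume "x \<in> I - A"
      then have "p x \<le> (\<Sum>x\<in>I. p x)" using fin by (intro member_le_sum) auto
      then have "real (p x + 1) \<le> real n" using sum n0 by linarith
      then have "ln (real (p x + 1)) \<le> lg" unfolding lg_def using n0 by (subst ln_le_cancel_iff) auto
      then have "real d * ln (real (p x + 1)) \<le> real d * lg" by (intro mult_left_mono) auto
      then show "ln_choose Y (p x) \<le> real d * lg" using ln_choose_le_ln[of Y "p x"] by (simp add: d_def)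
    qed
    also have "\<dots> = real (card (I - A)) * real d * lg" by simp
    also have "\<dots> \<le> real n powr 0.9 * lg" using ld lg by (intro mult_right_mono) auto
    finally show ?thesis .
  qed
  have "(\<Sum>x\<in>I. ln_choose Y (p x)) \<le> real s + 2 * real d ^ 2 + real n powr 0.9 * lg"
    using sum.subset_diff[OF fin(3,1), of "\<lambda>x. ln_choose Y (p x)"] small big by simp
  moreover have "ln (frobenius_degree Y) \<le> ln (hook_degree Y) + 2 * real d ^ 2 + 3 * (\<Sum>x\<in>I. ln_choose Y (p x))"
    using ln_frobenius_degree_le_general[OF Y] n0 sum_frob_index[of "ln_choose Y" Y]
    by (simp add: n_def d_def I_def p_def)
  \<comment> \<open>The total is \<open>8 * d ^ 2 + 3 * s + 3 * n powr 0.9 * lg\<close>, and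
    \<open>dsq\<close> turns the squares into \<open>8 * s + 16 * n powr 0.9\<close>.\<close>
  ultimately have "ln (frobenius_degree Y) - ln (hook_degree Y) \<le>
      11 * real s + 16 * real n powr 0.9 + 3 * (real n powr 0.9 * lg)"
    using dsq by simp
  also have "\<dots> \<le> 11 * real s + 19 * (real n powr 0.9 * lg)"
    using mult_left_mono[of 1 lg "real n powr 0.9"] lg by (simp add: mult.commute)
  finally have "(ln (frobenius_degree Y) - ln (hook_degree Y)) * lg \<le>
      (11 * real s + 19 * (real n powr 0.9 * lg)) * lg"
    using lg by (intro mult_right_mono) auto
  also have "\<dots> = 110 * (0.1 * lg * real s) + 19 * (real n powr 0.9 * lg ^ 2)"
    by (simp add: algebra_simps power2_eq_square)
  also have "\<dots> \<le> 110 * ln (frobenius_degree Y) + 19 * (32 * ln (frobenius_degree Y))"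
  proof -
    have "0.1 * lg * real s \<le> ln (frobenius_degree Y)"
      unfolding D s_def lg_def
      by (rule ln_multinomial_ge_below_threshold[OF fin(1,3) sum])
        (use n0 lg in \<open>auto simp: A_def lg_def\<close>)
    moreover have "real n powr 0.9 * lg ^ 2 \<le> 32 * ln (frobenius_degree Y)"
      using growth ln_frobenius_degree_ge_power[OF Y k rc L large] by (simp add: n_def lg_def)
    ultimately show ?thesis by simp
  qed
  \<comment> \<open>110 + 19 * 32 = 718; the value 1400 from the small-codegree case gives one
    constant for both.\<close>
  also have "\<dots> \<le> 1400 * ln (frobenius_degree Y)"
  proof -
    have "0 \<le> real (card Y) powr 0.95 / 32" by simp
    also note ln_frobenius_degree_ge_power[OF Y k rc L large]
    finally show ?thesis by simp
  qed
  finally show ?thesis by (simp add: n_def lg_def)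
qed

section \<open>Joining the cases; single rows and columns, small diagrams, the constant\<close>

lemma frobenius_degree_pos: "0 < frobenius_degree Y"
  unfolding frobenius_degree_def by (intro divide_pos_pos prod_pos) auto

lemma ln_degree_diff_le_long_row:
  assumes Y: "diagram Y" and k: "row Y 1 < card Y" and rc: "col Y 1 \<le> row Y 1"
    and L: "100 \<le> ln (real (card Y))"
    and growth: "real (card Y) powr 0.9 * ln (real (card Y)) ^ 2 \<le> real (card Y) powr 0.95"
  shows "(ln (frobenius_degree Y) - ln (hook_degree Y)) * ln (real (card Y)) \<le>
    1400 * ln (frobenius_degree Y)"
proof (cases "real (card Y - row Y 1) \<le> real (card Y) powr 0.95")
  case True
  then show ?thesis using k by (intro ln_degree_diff_le_small_codegree[OF Y refl _ L]) auto
next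
  case False
  then show ?thesis by (intro ln_degree_diff_le_large_codegree[OF Y refl rc L _ growth]) auto
qed

text \<open>Both degrees are invariant under conjugation, so the longer of first row and first
  column may be taken to be the row.\<close>

lemma ln_degree_diff_le:
  assumes Y: "diagram Y" and k: "row Y 1 < card Y" "col Y 1 < card Y"
    and L: "100 \<le> ln (real (card Y))"
    and growth: "real (card Y) powr 0.9 * ln (real (card Y)) ^ 2 \<le> real (card Y) powr 0.95"
  shows "(ln (frobenius_degree Y) - ln (hook_degree Y)) * ln (real (card Y)) \<le>
    1400 * ln (frobenius_degree Y)"
proof (cases "col Y 1 \<le> row Y 1")
  case True
  then show ?thesis using ln_degree_diff_le_long_row[OF Y k(1) _ L growth] by simp
next
  case False
  then show ?thesis using ln_degree_diff_le_long_row[OF diagram_conjugate[OF Y]] k(2) L growth by simp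
qed

text \<open>The coordinate \<open>row Y 1 - 1 = card Y - 1\<close> exhausts the count in
  \<open>card_diagram_split\<close>, so the other one vanishes and the factorials cancel. Such
  shapes are treated apart because their only tableau makes ln d zero.\<close>

lemma frobenius_degree_single_row:
  assumes Y: "diagram Y" and ne: "card Y > 0" and r: "row Y 1 = card Y"
  shows "frobenius_degree Y = 1"
proof -
  have d1: "1 \<le> durfee Y" by (rule durfee_pos[OF Y ne])
  have c: "card Y = (\<Sum>i\<in>{1..durfee Y}. (row Y i - i) + (col Y i - i)) + durfee Y"
    by (rule card_diagram_split[OF Y])
  have I: "{1..durfee Y} = insert 1 {2..durfee Y}" using d1 by auto
  have "(\<Sum>i\<in>{1..durfee Y}. (row Y i - i) + (col Y i - i)) =
      (row Y 1 - 1) + (col Y 1 - 1) + (\<Sum>i\<in>{2..durfee Y}. (row Y i - i) + (col Y i - i))"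
    unfolding I by simp
  then have "durfee Y = 1" "col Y 1 - 1 = 0" using c r d1 ne by linarith+
  then show ?thesis using r by (simp add: frobenius_degree_def)
qed

lemma SYT_nonempty:
  assumes "diagram Y"
  shows "1 \<le> card (SYT Y)"
proof -
  have "0 < fact (card Y) / hook_prod Y" using hook_prod_pos[of Y] by simp
  also have "\<dots> \<le> real (card (SYT Y))" by (rule hook_length_bound[OF assms])
  finally show ?thesis by simp
qed

text \<open>Small diagrams are absorbed into the constant only if ln d stays away from 0. A corner
  other than the two given cells can be deleted; if there is none, both cells are corners and each
  branch contributes a tableau.\<close>

lemma two_le_card_SYT_hook:
  assumes "diagram Y" "(1, 2) \<in> Y" "(2, 1) \<in> Y"
  shows "2 \<le> card (SYT Y)"
  using assms
proof (induction "card Y" arbitrary: Y rule: less_induct)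
  case less
  note Y = less.prems(1)
  have fin: "finite (corners Y)" by (rule finite_corners[OF Y])
  show ?case
  proof (cases "\<exists>c\<in>corners Y. c \<noteq> (1, 2) \<and> c \<noteq> (2, 1)")
    case True
    then obtain c where c: "c \<in> corners Y" "c \<noteq> (1, 2)" "c \<noteq> (2, 1)" by blast
    have cY: "c \<in> Y" using c(1) by (auto simp: corners_def)
    have "card (Y - {c}) < card Y" using cY finite_diagram[OF Y] by (rule card_Diff1_less[rotated])
    then have "2 \<le> card (SYT (Y - {c}))"
      using less.hyps[OF _ diagram_remove[OF Y c(1)]] less.prems c by auto
    also have "\<dots> \<le> (\<Sum>c\<in>corners Y. card (SYT (Y - {c})))"
      using fin c(1) by (intro member_le_sum) auto
    also have "\<dots> \<le> card (SYT Y)" by (rule SYT_branching[OF Y])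
    finally show ?thesis .
  next
    case False
    \<comment> \<open>Without a corner weakly below and to the right of the cell,
      \<open>hook_walk\<close> would vanish at every corner, against its total mass 1.\<close>
    have ex: "\<exists>c\<in>corners Y. i \<le> fst c \<and> j \<le> snd c" if "(i, j) \<in> Y" for i j
    proof (rule ccontr)
      assume "\<not> ?thesis"
      then have "(\<Sum>c\<in>corners Y. hook_walk Y c i j) = 0"
        by (intro sum.neutral) (auto simp: hook_walk_def)
      then show False using sum_hook_walk[OF Y that] by simp
    qed
    have c12: "(1, 2) \<in> corners Y" "(2, 1) \<in> corners Y"
      using ex[OF less.prems(2)] ex[OF less.prems(3)] False by fastforce+
    have "2 = (\<Sum>c\<in>{(1, 2), (2, 1) :: nat \<times> nat}. 1 :: nat)" by simp
    also have "\<dots> \<le> (\<Sum>c\<in>{(1, 2), (2, 1)}. card (SYT (Y - {c})))"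
      by (rule sum_mono) (use c12 SYT_nonempty[OF diagram_remove[OF Y]] in auto)
    also have "\<dots> \<le> (\<Sum>c\<in>corners Y. card (SYT (Y - {c})))"
      using fin c12 by (intro sum_mono2) auto
    also have "\<dots> \<le> card (SYT Y)" by (rule SYT_branching[OF Y])
    finally show ?thesis .
  qed
qed

lemma second_column_nonempty:
  assumes Y: "diagram Y" and c: "col Y 1 < card Y"
  shows "(1, 2) \<in> Y"
proof (rule ccontr)
  assume "(1, 2) \<notin> Y"
  then have "j = 1" if "(i, j) \<in> Y" for i j
    using diagram_down[OF Y that, of 1 2] diagram_pos[OF Y that] by (cases "j = 1") auto
  then have "Y \<subseteq> (\<lambda>i. (i, 1)) ` {i. (i, 1) \<in> Y}" by force
  moreover have "finite {i. (i, 1) \<in> Y}"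
    using finite_diagram[OF Y] by (rule finite_subset[rotated, OF finite_imageI[of _ fst]]) force
  ultimately have "card Y \<le> card {i. (i, 1) \<in> Y}" by (meson card_image_le card_mono finite_imageI le_trans)
  then show False using c by (simp add: col_def)
qed

lemma two_le_card_SYT_not_line:
  assumes Y: "diagram Y" and k: "row Y 1 < card Y" "col Y 1 < card Y"
  shows "2 \<le> card (SYT Y)"
  using two_le_card_SYT_hook[OF Y second_column_nonempty[OF Y k(2)]] second_column_nonempty[OF diagram_conjugate[OF Y]] k(1)
  by simp

lemma row_le_card:
  assumes Y: "diagram Y"
  shows "row Y i \<le> card Y"
proof -
  have "Pair i ` {1..row Y i} \<subseteq> Y" using mem_row[OF Y] by auto
  then have "card (Pair i ` {1..row Y i}) \<le> card Y"
    by (rule card_mono[OF finite_diagram[OF Y]])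
  then show ?thesis by (simp add: card_image inj_on_def)
qed

lemma frobenius_degree_le_fact: "frobenius_degree Y \<le> fact (card Y)"
proof -
  have "1 \<le> (\<Prod>i\<in>{1..durfee Y}. fact (row Y i - i) * fact (col Y i - i) :: real)"
    by (rule prod_ge_1) (metis fact_ge_1 mult_mono mult_1 zero_le_one fact_ge_zero)
  then have "frobenius_degree Y \<le> fact (card Y - 1) / 1"
    unfolding frobenius_degree_def by (intro divide_left_mono) auto
  also have "\<dots> \<le> fact (card Y)" by (simp add: fact_mono)
  finally show ?thesis .
qed

lemma frobenius_degree_le_powr:
  "\<exists>C\<ge>0. \<forall>Y. diagram Y \<longrightarrow> 2 \<le> card Y \<longrightarrow>
     frobenius_degree Y \<le> real (card (SYT Y)) powr (1 + C / ln (real (card Y)))"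
proof -
  have "eventually (\<lambda>n::nat. 2800 \<le> ln (real n) \<and>
      real n powr 0.9 * ln (real n) ^ 2 \<le> real n powr 0.95) at_top"
    by (intro eventually_conj) real_asymp+
  then obtain n0 where n0: "\<And>n. n \<ge> n0 \<Longrightarrow> 2800 \<le> ln (real n)"
    "\<And>n. n \<ge> n0 \<Longrightarrow> real n powr 0.9 * ln (real n) ^ 2 \<le> real n powr 0.95"
    unfolding eventually_at_top_linorder by blast
  \<comment> \<open>The summand 2800 serves diagrams with at least \<open>n0\<close> cells; the
    product serves the smaller ones, where \<open>D\<close> is at most \<open>fact n0\<close> and
    \<open>f\<close> is at least 2 outside single rows and columns.\<close>
  define C where "C = 2800 + ln (real (n0 + 2)) * (ln (fact n0) / ln 2)"
  have C0: "0 \<le> C" unfolding C_def by (intro add_nonneg_nonneg mult_nonneg_nonneg divide_nonneg_nonneg) auto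
  show ?thesis
  proof (intro exI[of _ C] conjI C0 allI impI)
    fix Y :: "(nat \<times> nat) set" assume Y: "diagram Y" and n2: "2 \<le> card Y"
    define n where "n = card Y"
    define D where "D = frobenius_degree Y"
    define f where "f = real (card (SYT Y))"
    have f1: "1 \<le> f" using SYT_nonempty[OF Y] by (simp add: f_def)
    have lnn: "0 < ln (real n)" using n2 by (simp add: n_def)
    have D0: "0 < D" by (simp add: D_def frobenius_degree_pos)
    have rowle: "row Y 1 \<le> card Y" "col Y 1 \<le> card Y"
      using row_le_card[OF Y] row_le_card[OF diagram_conjugate[OF Y]] by simp_all
    have "D \<le> f powr (1 + C / ln (real n))"
    proof (cases "row Y 1 = card Y \<or> col Y 1 = card Y")
      case True
      then have "D = 1"
        using frobenius_degree_single_row[OF Y] frobenius_degree_single_row[OF diagram_conjugate[OF Y]] n2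
        by (auto simp: D_def)
      then show ?thesis using f1 C0 lnn by (simp add: ge_one_powr_ge_zero)
    next
      case False
      then have k: "row Y 1 < card Y" "col Y 1 < card Y" using rowle by auto
      have "ln D \<le> (1 + C / ln (real n)) * ln f"
      proof (cases "n0 \<le> n")
        case True
        define x where "x = ln D"
        define y where "y = ln f"
        define L where "L = ln (real n)"
        have L: "2800 \<le> L" using n0(1)[OF True] by (simp add: L_def)
        have "ln (hook_degree Y) \<le> y"
          using hook_length_bound[OF Y] hook_degree_pos[of Y] f1
          unfolding y_def f_def hook_degree_def by (subst ln_le_cancel_iff) auto
        then have "(x - y) * L \<le> (x - ln (hook_degree Y)) * L"
          using L by (intro mult_right_mono) auto
        also have "\<dots> \<le> 1400 * x"
          using ln_degree_diff_le[OF Y k] L n0(2)[OF True] by (simp add: x_def D_def L_def n_def)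
        finally have le: "(x - y) * L \<le> 1400 * x" .
        have y0: "0 \<le> y" using f1 by (simp add: y_def)
        have "x * (L - 1400) \<le> y * L" using le by (simp add: algebra_simps)
        \<comment> \<open>Since \<open>L\<close> is at least 2 * 1400, the error
          \<open>x - y\<close> is at most \<open>x / 2\<close>; the bound \<open>1400 * x\<close>
          thereby becomes \<open>2800 * y\<close>.\<close>
        have "x \<le> 2 * y"
        proof (rule ccontr)
          assume "\<not> x \<le> 2 * y"
          then have "x / 2 < x - y" "0 < x" using y0 by auto
          then have "x / 2 * L < (x - y) * L" using L by (intro mult_strict_right_mono) auto
          moreover have "x / 2 * 2800 \<le> x / 2 * L" using L \<open>0 < x\<close> by (intro mult_left_mono) auto
          ultimately show False using le by simp
        qed
        then have "(x - y) * L \<le> 2800 * y" using le by simp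
        then have "x \<le> (1 + 2800 / L) * y" using L by (simp add: field_simps)
        also have "\<dots> \<le> (1 + C / L) * y"
          using y0 L by (intro mult_right_mono add_left_mono divide_right_mono) (auto simp: C_def)
        finally show ?thesis by (simp add: x_def y_def L_def)
      next
        case False
        have "D \<le> fact n" using frobenius_degree_le_fact[of Y] by (simp add: D_def n_def)
        also have "\<dots> \<le> fact n0" using False by (intro fact_mono) auto
        finally have "ln D \<le> ln (fact n0)" using D0 by simp
        also have "\<dots> = (ln (fact n0) / ln 2) * ln 2" by simp
        also have "\<dots> \<le> (C / ln (real n)) * ln f"
        proof (intro mult_mono)
          have "ln (real n) * (ln (fact n0) / ln 2) \<le> ln (real (n0 + 2)) * (ln (fact n0) / ln 2)"
            using False n2 by (intro mult_right_mono) (auto simp: n_def)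
          also have "\<dots> \<le> C" by (simp add: C_def)
          finally show "ln (fact n0) / ln 2 \<le> C / ln (real n)"
            using lnn by (simp add: pos_le_divide_eq mult.commute)
          show "ln 2 \<le> ln f" using two_le_card_SYT_not_line[OF Y k] by (simp add: f_def)
        qed (use C0 lnn in auto)
        also have "\<dots> \<le> (1 + C / ln (real n)) * ln f"
          using f1 by (intro mult_right_mono) auto
        finally show ?thesis .
      qed
      then have "exp (ln D) \<le> exp ((1 + C / ln (real n)) * ln f)" by simp
      then show ?thesis using D0 f1 by (simp add: powr_def)
    qed
    then show "frobenius_degree Y \<le> real (card (SYT Y)) powr (1 + C / ln (real (card Y)))"
      by (simp add: D_def f_def n_def)
  qed
qed


section \<open>Partitions\<close>

lemma row_length_antimono:
  assumes "sorted_wrt (\<ge>) l" "1 \<le> i" "i \<le> i'"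
  shows "row_length l i' \<le> row_length l i"
proof (cases "i = i' \<or> length l < i'")
  case False
  then have "i - 1 < i' - 1" "i' - 1 < length l" using assms by auto
  then show ?thesis
    using sorted_wrt_nth_less[OF assms(1), of "i - 1" "i' - 1"] assms by (simp add: row_length_def)
qed (auto simp: row_length_def)

lemma young_diagram_Sigma:
  "young_diagram l = (SIGMA i:{1..length l}. {1..row_length l i})"
  by (auto simp: young_diagram_def row_length_def split: if_splits)

lemma diagram_young_diagram:
  assumes "l \<turnstile>\<^sub>p n"
  shows "diagram (young_diagram l)"
proof -
  have l: "sorted_wrt (\<ge>) l" using assms by (simp add: partition_of_def)
  show ?thesis
    unfolding diagram_def
  proof (intro conjI allI impI)
    show "finite (young_diagram l)" unfolding young_diagram_Sigma by simp
  next
    fix i j i' j' assume "(i, j) \<in> young_diagram l" "1 \<le> i'" "i' \<le> i" "1 \<le> j'" "j' \<le> j"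
    then show "(i', j') \<in> young_diagram l"
      using row_length_antimono[OF l, of i' i] by (auto simp: young_diagram_def)
  qed (auto simp: young_diagram_def)
qed

lemma card_young_diagram: "card (young_diagram l) = sum_list l"
proof -
  have "card (young_diagram l) = (\<Sum>i\<in>{1..length l}. row_length l i)"
    unfolding young_diagram_Sigma by simp
  also have "\<dots> = (\<Sum>i\<in>{..<length l}. l ! i)"
    by (rule sum.reindex_bij_witness[of _ Suc "\<lambda>i. i - 1"]) (auto simp: row_length_def)
  finally show ?thesis by (simp add: sum_list_sum_nth atLeast0LessThan)
qed

lemma row_young_diagram:
  assumes "1 \<le> i"
  shows "row (young_diagram l) i = row_length l i"
proof -
  have "{j. (i, j) \<in> young_diagram l} = {1..row_length l i}"
    using assms by (auto simp: young_diagram_def)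
  then show ?thesis by (simp add: row_def)
qed

lemma col_young_diagram: "col (young_diagram l) j = col_length l j"
  by (simp add: col_def col_length_def)

lemma durfee_young_diagram: "durfee (young_diagram l) = diagonal_length l"
  by (simp add: durfee_def diagonal_length_def young_diagram_def conj_commute)

lemma irrep_dim_eq: "irrep_dim l = card (SYT (young_diagram l))"
  by (simp add: irrep_dim_def standard_tableaux_def SYT_def card_young_diagram)

lemma virtual_degree_eq: "virtual_degree l = frobenius_degree (young_diagram l)"
  by (simp add: virtual_degree_def frobenius_degree_def card_young_diagram durfee_young_diagram
      col_young_diagram row_young_diagram)

theorem theorem1p5:
  "\<exists>C::real. \<forall>n::nat. \<forall>l::nat list. 2 \<le> n \<longrightarrow> l \<turnstile>\<^sub>p n \<longrightarrow>
     virtual_degree l \<le> real (irrep_dim l) powr (1 + C / ln (real n))"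
proof -
  obtain C where C: "\<And>Y. diagram Y \<Longrightarrow> 2 \<le> card Y \<Longrightarrow>
     frobenius_degree Y \<le> real (card (SYT Y)) powr (1 + C / ln (real (card Y)))"
    using frobenius_degree_le_powr by blast
  show ?thesis
  proof (intro exI[of _ C] allI impI)
    fix n l assume n: "2 \<le> n" and l: "l \<turnstile>\<^sub>p n"
    have "card (young_diagram l) = n" using l by (simp add: card_young_diagram partition_of_def)
    then show "virtual_degree l \<le> real (irrep_dim l) powr (1 + C / ln (real n))"
      using C[OF diagram_young_diagram[OF l]] n by (simp add: virtual_degree_eq irrep_dim_eq)
  qed
qed

end
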